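(* Let $\mathbb X$ be a developable complex of groups over a connected scwol $X$, let $\sigma_0\in VX$, and let $\bar{\mathbb X}$ be the complex of groups induced by the action of $\pi_1(\mathbb X,\sigma_0)$ on the universal complex $\tilde X_{\sigma_0}$. Then there exists an isomorphism of complexes of groups $\phi:\mathbb X\to\bar{\mathbb X}$.
   Context: Scwols. A scwol $X$ consists of sets $VX$ (vertices), $EX$ (edges), maps $i,t:EX\to VX$ and a composition $E^2X:=\{(a,b)\in EX\times EX: i(a)=t(b)\}\to EX$, $(a,b)\mapsto ab$, with $i(ab)=i(b)$, $t(ab)=t(a)$; $(ab)c=a(bc)$ whenever $i(a)=t(b)$, $i(b)=t(c)$; and $i(a)\neq t(a)$ for all $a\in EX$. $E^3X$ is the set of triples of edges $(a,b,c)$ with $i(a)=t(b)$, $i(b)=t(c)$. A morphism of scwols $f:X\to Y$ maps vertices to vertices and edges to edges, commutes with $i,t$, satisfies $f(ab)=f(a)f(b)$ for $(a,b)\in E^2X$, and for each $\sigma\in VX$ restricts to a bijection $\{a\in EX:i(a)=\sigma\}\to\{a'\in EY:i(a')=f(\sigma)\}$; it is an isomorphism if bijective on vertices and edges. An action of a group $H$ on $X$ is a homomorphism from $H$ to the automorphism group of $X$ such that $h\cdot i(a)\ne t(a)$ for all $h\in H,a\in EX$, and $h\cdot i(a)=i(a)$ implies $h\cdot a=a$. Complexes of groups. A complex of groups $\mathbb X$ over $X$ is a tuple $((G_\sigma)_{\sigma\in VX},(\psi_a)_{a\in EX},(g_{a,b})_{(a,b)\in E^2X})$ with groups $G_\sigma$,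 injective homomorphisms $\psi_a:G_{i(a)}\to G_{t(a)}$ and elements $g_{a,b}\in G_{t(a)}$ such that $c_{g_{a,b}}\circ\psi_{ab}=\psi_a\circ\psi_b$ on $E^2X$ and $\psi_a(g_{b,c})g_{a,bc}=g_{a,b}g_{ab,c}$ on $E^3X$, where $c_h(g)=hgh^{-1}$. Morphisms. A morphism $\phi:\mathbb X\to\mathbb Y$ over $f:X\to Y$ consists of $f$, homomorphisms $\phi_\sigma:G_\sigma\to G_{f(\sigma)}$ ($\sigma\in VX$) and elements $\phi(a)\in G_{f(t(a))}$ ($a\in EX$) with $c_{\phi(a)}\circ\psi_{f(a)}\circ\phi_{i(a)}=\phi_{t(a)}\circ\psi_a$ for $a\in EX$ and $\phi_{t(a)}(g_{a,b})\phi(ab)=\phi(a)\psi_{f(a)}(\phi(b))g_{f(a),f(b)}$ for $(a,b)\in E^2X$. It is an isomorphism if $f$ and all $\phi_\sigma$ are isomorphisms. Complex of groups induced by an action. Let a group $H$ act on a scwol $Z$ and let $W=H\backslash Z$ be the quotient scwol. For each $\sigma\in VW$ choose a representative $\tilde\sigma\in VZ$; for $a\in EW$ let $\tilde a\in EZ$ be the unique edge over $a$ with $i(\tilde a)=\widetilde{i(a)}$, and choose $h_a\in H$ with $h_a\cdot t(\tilde a)=\widetilde{t(a)}$. The induced complex of groups over $W$ has $G_\sigma$ the stabilizer of $\tilde\sigma$ in $H$, $\psi_a=c_{h_a}|_{G_{i(a)}}$, $g_{a,b}=h_ah_bh_{ab}^{-1}$ (different choices give isomorphic complexes of groups). Paths.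 Oriented edges are the $a\in EX$ and formal inverses $a^{-1}$, with $i(a^{-1})=t(a)$, $t(a^{-1})=i(a)$, $(a^{-1})^{-1}=a$. A path in $X$ is a finite sequence of oriented edges $(e_1,\dots,e_k)$ with $t(e_j)=i(e_{j+1})$; $X$ is connected if any two vertices are joined by a finite path. An $\mathbb X$-path is a tuple $p=(g_0,e_1,g_1,\dots,e_k,g_k)$ with $(e_1,\dots,e_k)$ a path, $g_0\in G_{i(e_1)}$, $g_j\in G_{t(e_j)}$; $i(p)=i(e_1)$, $t(p)=t(e_k)$ (for length $0$: $p=(g)$ with $g\in G_\sigma$, at a vertex $\sigma$). Concatenation $p\star q$ (when $t(p)=i(q)$) multiplies the last group element of $p$ with the first of $q$. $\mathcal P_{\sigma_0}(\mathbb X)$ denotes the set of $\mathbb X$-paths starting at $\sigma_0$. Homotopy $\sim$ of $\mathbb X$-paths is the equivalence relation generated by the following replacements of subpaths: $(kg,a,h)\to(k,a,\psi_a(g)h)$; $(g,a^{-1},hk)\to(g\psi_a(h),a^{-1},k)$; $(g,a,\psi_a(h),a^{-1},k)\to(ghk)$; $(g,b^{-1},h,b,k)\to(g\psi_b(h)k)$; $(g,b,1,a,k)\to(g,ab,g_{a,b}^{-1}k)$ and $(g,a^{-1},1,b^{-1},k)\to(gg_{a,b},(ab)^{-1},k)$ for $(a,b)\in E^2X$. $[p]$ is the homotopy class. $\pi_1(\mathbb X,\sigma_0)$ is the group of homotopy classes of $\mathbb X$-paths from $\sigma_0$ to $\sigma_0$ with $[p][q]=[p\star q]$. $\mathbb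 X$ is developable if it is isomorphic to a complex of groups induced by an action of a group on a scwol; equivalently (and this may be taken as the definition), for every $\sigma\in VX$ the homomorphism $G_\sigma\to\pi_1(\mathbb X,\sigma)$, $g\mapsto[(g)]$, is injective. Universal complex. For $p,q\in\mathcal P_{\sigma_0}(\mathbb X)$ put $p\equiv q$ iff $[q]=[p\star(g)]$ for some $g\in G_{t(p)}$; $[\![p]\!]$ is the $\equiv$-class. The scwol $\tilde X_{\sigma_0}$ has vertices $[\![p]\!]$, $p\in\mathcal P_{\sigma_0}(\mathbb X)$, edges the triples $([\![p]\!],a,[\![p\star(1,a,1)]\!])$ with $a\in EX$, $i(a)=t(p)$; $i,t$ are the first and third projections, and the composite of $([\![p\star(1,b,1)]\!],a,\cdot)$ with $([\![p]\!],b,\cdot)$ is $([\![p]\!],ab,[\![p\star(1,ab,1)]\!])$. $\pi_1(\mathbb X,\sigma_0)$ acts on it by $[q]\cdot[\![p]\!]=[\![q\star p]\!]$ and $[q]\cdot([\![p]\!],a,\cdot)=([\![q\star p]\!],a,\cdot)$. *)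

theory Defs
  imports "HOL-Algebra.Group_Action"
begin

section \<open>Scwols\<close>

text \<open>
  As usual for carrier-based structures, \<^term>\<open>ini X\<close>, \<^term>\<open>trm X\<close> and \<^term>\<open>cmp X\<close> are total
  functions of which only the values on \<^term>\<open>edges X\<close>, respectively on composable pairs of
  edges, are relevant. The composite \<^term>\<open>cmp X a b\<close> is defined when \<^prop>\<open>ini X a = trm X b\<close>:
  \<open>b\<close> comes first.
\<close>

record ('v, 'e) scwol =
  verts :: "'v set"
  edges :: "'e set"
  ini :: "'e \<Rightarrow> 'v"
  trm :: "'e \<Rightarrow> 'v"
  cmp :: "'e \<Rightarrow> 'e \<Rightarrow> 'e"

locale scwol =
  fixes X :: "('v, 'e, 'x) scwol_scheme"
  assumes ini_closed: "a \<in> edges X \<Longrightarrow> ini X a \<in> verts X"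
    and trm_closed: "a \<in> edges X \<Longrightarrow> trm X a \<in> verts X"
    and cmp_closed: "\<lbrakk>a \<in> edges X; b \<in> edges X; ini X a = trm X b\<rbrakk> \<Longrightarrow> cmp X a b \<in> edges X"
    and ini_cmp: "\<lbrakk>a \<in> edges X; b \<in> edges X; ini X a = trm X b\<rbrakk> \<Longrightarrow> ini X (cmp X a b) = ini X b"
    and trm_cmp: "\<lbrakk>a \<in> edges X; b \<in> edges X; ini X a = trm X b\<rbrakk> \<Longrightarrow> trm X (cmp X a b) = trm X a"
    and cmp_assoc: "\<lbrakk>a \<in> edges X; b \<in> edges X; c \<in> edges X; ini X a = trm X b; ini X b = trm X c\<rbrakk>
      \<Longrightarrow> cmp X (cmp X a b) c = cmp X a (cmp X b c)"
    and no_loops: "a \<in> edges X \<Longrightarrow> ini X a \<noteq> trm X a"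

locale scwol_morphism = source: scwol X + target: scwol Y
  for X :: "('v, 'e, 'x) scwol_scheme" and Y :: "('w, 'f, 'y) scwol_scheme" +
  fixes fv :: "'v \<Rightarrow> 'w" and fe :: "'e \<Rightarrow> 'f"
  assumes vert_closed: "\<sigma> \<in> verts X \<Longrightarrow> fv \<sigma> \<in> verts Y"
    and edge_closed: "a \<in> edges X \<Longrightarrow> fe a \<in> edges Y"
    and ini_commute: "a \<in> edges X \<Longrightarrow> ini Y (fe a) = fv (ini X a)"
    and trm_commute: "a \<in> edges X \<Longrightarrow> trm Y (fe a) = fv (trm X a)"
    and cmp_commute: "\<lbrakk>a \<in> edges X; b \<in> edges X; ini X a = trm X b\<rbrakk>
      \<Longrightarrow> fe (cmp X a b) = cmp Y (fe a) (fe b)"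
    and star_bij: "\<sigma> \<in> verts X \<Longrightarrow>
      bij_betw fe {a \<in> edges X. ini X a = \<sigma>} {a' \<in> edges Y. ini Y a' = fv \<sigma>}"

definition scwol_isomorphism ::
  "('v, 'e, 'x) scwol_scheme \<Rightarrow> ('w, 'f, 'y) scwol_scheme \<Rightarrow> ('v \<Rightarrow> 'w) \<Rightarrow> ('e \<Rightarrow> 'f) \<Rightarrow> bool" where
  "scwol_isomorphism X Y fv fe \<longleftrightarrow>
    scwol_morphism X Y fv fe \<and>
    bij_betw fv (verts X) (verts Y) \<and> bij_betw fe (edges X) (edges Y)"

text \<open>
  An action consists of an action on vertices and one on edges. We do not use \<^locale>\<open>group_action\<close>,
  which would require the maps to be extensional.
\<close>

locale scwol_action = group H + scwol Z
  for H (structure) and Z :: "('v, 'e, 'z) scwol_scheme" +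
  fixes actv :: "'h \<Rightarrow> 'v \<Rightarrow> 'v" and acte :: "'h \<Rightarrow> 'e \<Rightarrow> 'e"
  assumes automorphism: "h \<in> carrier H \<Longrightarrow> scwol_isomorphism Z Z (actv h) (acte h)"
    and actv_mult: "\<lbrakk>h \<in> carrier H; k \<in> carrier H; \<sigma> \<in> verts Z\<rbrakk>
      \<Longrightarrow> actv (h \<otimes> k) \<sigma> = actv h (actv k \<sigma>)"
    and acte_mult: "\<lbrakk>h \<in> carrier H; k \<in> carrier H; a \<in> edges Z\<rbrakk>
      \<Longrightarrow> acte (h \<otimes> k) a = acte h (acte k a)"
    and ini_not_to_trm: "\<lbrakk>h \<in> carrier H; a \<in> edges Z\<rbrakk> \<Longrightarrow> actv h (ini Z a) \<noteq> trm Z a"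
    and fix_ini_fix_edge: "\<lbrakk>h \<in> carrier H; a \<in> edges Z; actv h (ini Z a) = ini Z a\<rbrakk>
      \<Longrightarrow> acte h a = a"

text \<open>
  Vertices and edges of the quotient are orbits, as sets. For an action, the image of an edge orbit
  under \<^term>\<open>ini Z\<close> or \<^term>\<open>trm Z\<close> is a vertex orbit, and the products of the composable
  representatives of two composable edge orbits form a single edge orbit.
\<close>

definition quotient_scwol ::
  "('h, 'm) monoid_scheme \<Rightarrow> ('v, 'e, 'z) scwol_scheme \<Rightarrow> ('h \<Rightarrow> 'v \<Rightarrow> 'v) \<Rightarrow> ('h \<Rightarrow> 'e \<Rightarrow> 'e)
    \<Rightarrow> ('v set, 'e set) scwol" where
  "quotient_scwol H Z actv acte =
    \<lparr>verts = orbits H (verts Z) actv,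
     edges = orbits H (edges Z) acte,
     ini = (\<lambda>A. ini Z ` A),
     trm = (\<lambda>A. trm Z ` A),
     cmp = (\<lambda>A B. {cmp Z a b | a b. a \<in> A \<and> b \<in> B \<and> ini Z a = trm Z b})\<rparr>"


section \<open>Complexes of groups\<close>

text \<open>
  The underlying scwol is part of the record. All local groups share the element type \<open>'g\<close>; this
  is no restriction, since they need not be disjoint or related in any way inside \<open>'g\<close>.
\<close>

record ('v, 'e, 'g) complex_of_groups = "('v, 'e) scwol" +
  grp :: "'v \<Rightarrow> 'g monoid"
  psi :: "'e \<Rightarrow> 'g \<Rightarrow> 'g"
  twist :: "'e \<Rightarrow> 'e \<Rightarrow> 'g"

definition conj_by :: "('g, 'm) monoid_scheme \<Rightarrow> 'g \<Rightarrow> 'g \<Rightarrow> 'g" where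
  "conj_by G h g = h \<otimes>\<^bsub>G\<^esub> g \<otimes>\<^bsub>G\<^esub> inv\<^bsub>G\<^esub> h"

locale complex_of_groups = scwol X
  for X :: "('v, 'e, 'g) complex_of_groups" +
  assumes group_grp: "\<sigma> \<in> verts X \<Longrightarrow> group (grp X \<sigma>)"
    and psi_hom: "a \<in> edges X \<Longrightarrow> psi X a \<in> hom (grp X (ini X a)) (grp X (trm X a))"
    and psi_inj: "a \<in> edges X \<Longrightarrow> inj_on (psi X a) (carrier (grp X (ini X a)))"
    and twist_closed: "\<lbrakk>a \<in> edges X; b \<in> edges X; ini X a = trm X b\<rbrakk>
      \<Longrightarrow> twist X a b \<in> carrier (grp X (trm X a))"
    and twist_conj: "\<lbrakk>a \<in> edges X; b \<in> edges X; ini X a = trm X b; g \<in> carrier (grp X (ini X b))\<rbrakk>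
      \<Longrightarrow> conj_by (grp X (trm X a)) (twist X a b) (psi X (cmp X a b) g) = psi X a (psi X b g)"
    and twist_cocycle: "\<lbrakk>a \<in> edges X; b \<in> edges X; c \<in> edges X; ini X a = trm X b; ini X b = trm X c\<rbrakk>
      \<Longrightarrow> psi X a (twist X b c) \<otimes>\<^bsub>grp X (trm X a)\<^esub> twist X a (cmp X b c)
        = twist X a b \<otimes>\<^bsub>grp X (trm X a)\<^esub> twist X (cmp X a b) c"

text \<open>
  In a morphism \<open>\<phi>\<close>, the fields are the maps of the underlying scwols, the local
  homomorphisms \<open>\<phi>\<^sub>\<sigma>\<close> and the elements \<open>\<phi>(a)\<close>.
\<close>

record ('v, 'e, 'g, 'w, 'f, 'k) complex_map =
  vmap :: "'v \<Rightarrow> 'w"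
  emap :: "'e \<Rightarrow> 'f"
  locmap :: "'v \<Rightarrow> 'g \<Rightarrow> 'k"
  elt :: "'e \<Rightarrow> 'k"

locale complex_morphism =
  source: complex_of_groups X + target: complex_of_groups Y +
  scwol_morphism X Y "vmap \<phi>" "emap \<phi>"
  for X :: "('v, 'e, 'g) complex_of_groups" and Y :: "('w, 'f, 'k) complex_of_groups"
    and \<phi> :: "('v, 'e, 'g, 'w, 'f, 'k) complex_map" +
  assumes locmap_hom: "\<sigma> \<in> verts X \<Longrightarrow> locmap \<phi> \<sigma> \<in> hom (grp X \<sigma>) (grp Y (vmap \<phi> \<sigma>))"
    and elt_closed: "a \<in> edges X \<Longrightarrow> elt \<phi> a \<in> carrier (grp Y (vmap \<phi> (trm X a)))"
    and elt_conj: "\<lbrakk>a \<in> edges X; g \<in> carrier (grp X (ini X a))\<rbrakk>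
      \<Longrightarrow> conj_by (grp Y (vmap \<phi> (trm X a))) (elt \<phi> a)
            (psi Y (emap \<phi> a) (locmap \<phi> (ini X a) g))
        = locmap \<phi> (trm X a) (psi X a g)"
    and elt_cmp: "\<lbrakk>a \<in> edges X; b \<in> edges X; ini X a = trm X b\<rbrakk>
      \<Longrightarrow> locmap \<phi> (trm X a) (twist X a b) \<otimes>\<^bsub>grp Y (vmap \<phi> (trm X a))\<^esub> elt \<phi> (cmp X a b)
        = elt \<phi> a \<otimes>\<^bsub>grp Y (vmap \<phi> (trm X a))\<^esub> psi Y (emap \<phi> a) (elt \<phi> b)
            \<otimes>\<^bsub>grp Y (vmap \<phi> (trm X a))\<^esub> twist Y (emap \<phi> a) (emap \<phi> b)"

definition complex_isomorphism ::
  "('v, 'e, 'g) complex_of_groups \<Rightarrow> ('w, 'f, 'k) complex_of_groups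
    \<Rightarrow> ('v, 'e, 'g, 'w, 'f, 'k) complex_map \<Rightarrow> bool" where
  "complex_isomorphism X Y \<phi> \<longleftrightarrow>
    complex_morphism X Y \<phi> \<and>
    scwol_isomorphism X Y (vmap \<phi>) (emap \<phi>) \<and>
    (\<forall>\<sigma>\<in>verts X. locmap \<phi> \<sigma> \<in> iso (grp X \<sigma>) (grp Y (vmap \<phi> \<sigma>)))"


section \<open>The complex of groups induced by an action\<close>

text \<open>
  The choices are a representative \<open>rep \<sigma>\<close> of every vertex orbit and an element \<open>h a\<close> for every
  edge orbit. The edge \<open>edge_lift Z rep a\<close> is the one over \<open>a\<close> that starts at the chosen
  representative; it is unique because an element fixing the initial vertex of an edge fixes the edge.
\<close>

definition edge_lift :: "('v, 'e, 'z) scwol_scheme \<Rightarrow> ('v set \<Rightarrow> 'v) \<Rightarrow> 'e set \<Rightarrow> 'e" where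
  "edge_lift Z rep a = (THE e. e \<in> a \<and> ini Z e = rep (ini Z ` a))"

definition induced_choice ::
  "('h, 'm) monoid_scheme \<Rightarrow> ('v, 'e, 'z) scwol_scheme \<Rightarrow> ('h \<Rightarrow> 'v \<Rightarrow> 'v) \<Rightarrow> ('h \<Rightarrow> 'e \<Rightarrow> 'e)
    \<Rightarrow> ('v set \<Rightarrow> 'v) \<Rightarrow> ('e set \<Rightarrow> 'h) \<Rightarrow> bool" where
  "induced_choice H Z actv acte rep h \<longleftrightarrow>
    (let W = quotient_scwol H Z actv acte in
      (\<forall>\<sigma>\<in>verts W. rep \<sigma> \<in> \<sigma>) \<and>
      (\<forall>a\<in>edges W. h a \<in> carrier H \<and>
        actv (h a) (trm Z (edge_lift Z rep a)) = rep (trm W a)))"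

text \<open>Every action admits such choices.\<close>

lemma (in scwol_action) induced_choice_exists:
  "\<exists>rep h. induced_choice H Z actv acte rep h"
proof -
  define W where "W = quotient_scwol H Z actv acte"
  have act_one: "acte \<one> a = a" if a: "a \<in> edges Z" for a
  proof -
    have iso: "scwol_isomorphism Z Z (actv \<one>) (acte \<one>)"
      by (rule automorphism) simp
    then have inj: "inj_on (acte \<one>) (edges Z)" and closed: "acte \<one> a \<in> edges Z"
      using a by (auto simp: scwol_isomorphism_def bij_betw_def)
    have "acte \<one> (acte \<one> a) = acte \<one> a"
      using acte_mult[of \<one> \<one> a] a by simp
    then show ?thesis using inj closed a by (auto dest: inj_onD)
  qed
  have act_one_v: "actv \<one> \<sigma> = \<sigma>" if \<sigma>: "\<sigma> \<in> verts Z" for \<sigma>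
  proof -
    have iso: "scwol_isomorphism Z Z (actv \<one>) (acte \<one>)"
      by (rule automorphism) simp
    then have inj: "inj_on (actv \<one>) (verts Z)" and closed: "actv \<one> \<sigma> \<in> verts Z"
      using \<sigma> by (auto simp: scwol_isomorphism_def bij_betw_def)
    have "actv \<one> (actv \<one> \<sigma>) = actv \<one> \<sigma>"
      using actv_mult[of \<one> \<one> \<sigma>] \<sigma> by simp
    then show ?thesis using inj closed \<sigma> by (auto dest: inj_onD)
  qed
  have morph: "scwol_morphism Z Z (actv k) (acte k)" if "k \<in> carrier H" for k
    using automorphism[OF that] by (simp add: scwol_isomorphism_def)
  have transl: "\<exists>k\<in>carrier H. actv k x = y" if xy: "\<sigma> \<in> verts Z"
    "x \<in> orbit H actv \<sigma>" "y \<in> orbit H actv \<sigma>" for \<sigma> x y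
  proof -
    obtain k l where kl: "k \<in> carrier H" "l \<in> carrier H" "x = actv k \<sigma>" "y = actv l \<sigma>"
      using xy by (auto simp: orbit_def)
    then have "actv (l \<otimes> inv k) x = y"
      using actv_mult[of "l \<otimes> inv k" k \<sigma>] xy(1) by (simp add: m_assoc)
    then show ?thesis using kl by blast
  qed
  define rep where "rep = (\<lambda>\<sigma>. SOME x::'v. x \<in> \<sigma>)"
  have rep: "rep \<sigma> \<in> \<sigma>" if "\<sigma> \<in> verts W" for \<sigma>
  proof -
    have "\<exists>x. x \<in> \<sigma>"
      using that by (auto simp: W_def quotient_scwol_def orbits_def orbit_def)
    then show ?thesis unfolding rep_def by (rule someI_ex)
  qed
  have "\<exists>k\<in>carrier H. actv k (trm Z (edge_lift Z rep a)) = rep (trm W a)"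
    if a: "a \<in> edges W" for a
  proof -
    obtain e where e: "e \<in> edges Z" "a = orbit H acte e"
      using a by (auto simp: W_def quotient_scwol_def orbits_def)
    have ia: "ini Z ` a = orbit H actv (ini Z e)" and ta: "trm Z ` a = orbit H actv (trm Z e)"
      using e scwol_morphism.ini_commute[OF morph] scwol_morphism.trm_commute[OF morph]
      by (force simp: orbit_def image_def)+
    have iW: "ini Z ` a \<in> verts W" and tW: "trm Z ` a \<in> verts W"
      using e ini_closed trm_closed ia ta by (auto simp: W_def quotient_scwol_def orbits_def)
    obtain k where k: "k \<in> carrier H" "ini Z (acte k e) = rep (ini Z ` a)"
      using rep[OF iW] e by (auto simp: orbit_def)
    have "x = acte k e" if x: "x \<in> a" "ini Z x = rep (ini Z ` a)" for x
    proof -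
      obtain l where l: "l \<in> carrier H" "x = acte l e" using x e by (auto simp: orbit_def)
      have eq: "actv l (ini Z e) = actv k (ini Z e)"
        using x(2) k l e scwol_morphism.ini_commute[OF morph] by auto
      have "actv (inv k \<otimes> l) (ini Z e) = ini Z e"
        using actv_mult[of "inv k" l "ini Z e"] actv_mult[of "inv k" k "ini Z e"] eq k l e
          ini_closed act_one_v by simp
      then have "acte (inv k \<otimes> l) e = e"
        using fix_ini_fix_edge k l e by simp
      then have "acte k e = acte (k \<otimes> (inv k \<otimes> l)) e"
        using acte_mult[of k "inv k \<otimes> l" e] k l e by simp
      also have "k \<otimes> (inv k \<otimes> l) = l" using k l by (simp add: m_assoc[symmetric])
      finally show ?thesis using l by simp
    qed
    then have lift: "edge_lift Z rep a = acte k e"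
      unfolding edge_lift_def using k e by (intro the_equality) (auto simp: orbit_def)
    have "trm Z (acte k e) \<in> trm Z ` a" using k e by (auto simp: orbit_def)
    then have "\<exists>l\<in>carrier H. actv l (trm Z (acte k e)) = rep (trm Z ` a)"
      using transl[OF trm_closed[OF e(1)]] rep[OF tW] unfolding ta by blast
    then show ?thesis by (simp add: lift W_def quotient_scwol_def)
  qed
  then obtain h where "\<forall>a\<in>edges W. h a \<in> carrier H \<and>
      actv (h a) (trm Z (edge_lift Z rep a)) = rep (trm W a)"
    by metis
  then have "induced_choice H Z actv acte rep h"
    using rep by (auto simp: induced_choice_def W_def[symmetric] Let_def)
  then show ?thesis by blast
qed

definition induced_complex ::
  "'h monoid \<Rightarrow> ('v, 'e, 'z) scwol_scheme \<Rightarrow> ('h \<Rightarrow> 'v \<Rightarrow> 'v) \<Rightarrow> ('h \<Rightarrow> 'e \<Rightarrow> 'e)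
    \<Rightarrow> ('v set \<Rightarrow> 'v) \<Rightarrow> ('e set \<Rightarrow> 'h) \<Rightarrow> ('v set, 'e set, 'h) complex_of_groups" where
  "induced_complex H Z actv acte rep h =
    (let W = quotient_scwol H Z actv acte in
      \<lparr>verts = verts W, edges = edges W, ini = ini W, trm = trm W, cmp = cmp W,
       grp = (\<lambda>\<sigma>. H\<lparr>carrier := stabilizer H actv (rep \<sigma>)\<rparr>),
       psi = (\<lambda>a. conj_by H (h a)),
       twist = (\<lambda>a b. h a \<otimes>\<^bsub>H\<^esub> h b \<otimes>\<^bsub>H\<^esub> inv\<^bsub>H\<^esub> (h (cmp W a b)))\<rparr>)"


section \<open>Paths and homotopy\<close>

datatype 'e oedge = Fwd 'e | Bwd 'e

fun oedge_in :: "('v, 'e, 'x) scwol_scheme \<Rightarrow> 'e oedge \<Rightarrow> bool" where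
  "oedge_in X (Fwd a) \<longleftrightarrow> a \<in> edges X"
| "oedge_in X (Bwd a) \<longleftrightarrow> a \<in> edges X"

fun oini :: "('v, 'e, 'x) scwol_scheme \<Rightarrow> 'e oedge \<Rightarrow> 'v" where
  "oini X (Fwd a) = ini X a"
| "oini X (Bwd a) = trm X a"

fun otrm :: "('v, 'e, 'x) scwol_scheme \<Rightarrow> 'e oedge \<Rightarrow> 'v" where
  "otrm X (Fwd a) = trm X a"
| "otrm X (Bwd a) = ini X a"

fun edge_path :: "('v, 'e, 'x) scwol_scheme \<Rightarrow> 'v \<Rightarrow> 'e oedge list \<Rightarrow> bool" where
  "edge_path X \<sigma> [] \<longleftrightarrow> \<sigma> \<in> verts X"
| "edge_path X \<sigma> (e # es) \<longleftrightarrow> oedge_in X e \<and> oini X e = \<sigma> \<and> edge_path X (otrm X e) es"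

definition edge_path_end :: "('v, 'e, 'x) scwol_scheme \<Rightarrow> 'v \<Rightarrow> 'e oedge list \<Rightarrow> 'v" where
  "edge_path_end X \<sigma> es = last (\<sigma> # map (otrm X) es)"

definition connected_scwol :: "('v, 'e, 'x) scwol_scheme \<Rightarrow> bool" where
  "connected_scwol X \<longleftrightarrow>
    (\<forall>\<sigma>\<in>verts X. \<forall>\<tau>\<in>verts X. \<exists>es. edge_path X \<sigma> es \<and> edge_path_end X \<sigma> es = \<tau>)"

text \<open>
  \<open>XPath \<sigma> g\<^sub>0 [(e\<^sub>1, g\<^sub>1), \<dots>, (e\<^sub>k, g\<^sub>k)]\<close> stands for the path
  \<open>(g\<^sub>0, e\<^sub>1, g\<^sub>1, \<dots>, e\<^sub>k, g\<^sub>k)\<close>. The initial vertex \<open>\<sigma>\<close> is recorded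
  because the local groups may overlap, so that a path of length 0 does not determine it.
\<close>

datatype ('v, 'e, 'g) xpath =
  XPath (xini: 'v) (xhead: 'g) (xsteps: "('e oedge \<times> 'g) list")

definition is_xpath :: "('v, 'e, 'g) complex_of_groups \<Rightarrow> ('v, 'e, 'g) xpath \<Rightarrow> bool" where
  "is_xpath X p \<longleftrightarrow>
    edge_path X (xini p) (map fst (xsteps p)) \<and>
    xhead p \<in> carrier (grp X (xini p)) \<and>
    (\<forall>(e, g) \<in> set (xsteps p). g \<in> carrier (grp X (otrm X e)))"

definition xtrm :: "('v, 'e, 'g) complex_of_groups \<Rightarrow> ('v, 'e, 'g) xpath \<Rightarrow> 'v" where
  "xtrm X p = edge_path_end X (xini p) (map fst (xsteps p))"

definition paths_from :: "('v, 'e, 'g) complex_of_groups \<Rightarrow> 'v \<Rightarrow> ('v, 'e, 'g) xpath set" where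
  "paths_from X \<sigma> = {p. is_xpath X p \<and> xini p = \<sigma>}"

fun concat_path :: "('v, 'e, 'g) complex_of_groups
    \<Rightarrow> ('v, 'e, 'g) xpath \<Rightarrow> ('v, 'e, 'g) xpath \<Rightarrow> ('v, 'e, 'g) xpath" where
  "concat_path X (XPath \<sigma> g []) q = XPath \<sigma> (g \<otimes>\<^bsub>grp X \<sigma>\<^esub> xhead q) (xsteps q)"
| "concat_path X (XPath \<sigma> g ((e, k) # s)) q =
    (let r = concat_path X (XPath (otrm X e) k s) q
     in XPath \<sigma> g ((e, xhead r) # xsteps r))"

definition const_path :: "'v \<Rightarrow> 'g \<Rightarrow> ('v, 'e, 'g) xpath" where
  "const_path \<sigma> g = XPath \<sigma> g []"

definition single_edge_path ::
  "('v, 'e, 'g) complex_of_groups \<Rightarrow> 'e \<Rightarrow> ('v, 'e, 'g) xpath" where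
  "single_edge_path X a =
    XPath (ini X a) \<one>\<^bsub>grp X (ini X a)\<^esub> [(Fwd a, \<one>\<^bsub>grp X (trm X a)\<^esub>)]"

inductive elementary_homotopy ::
  "('v, 'e, 'g) complex_of_groups \<Rightarrow> ('v, 'e, 'g) xpath \<Rightarrow> ('v, 'e, 'g) xpath \<Rightarrow> bool"
  for X where
  push_fwd:
  "\<lbrakk>a \<in> edges X; k \<in> carrier (grp X (ini X a)); g \<in> carrier (grp X (ini X a));
    h \<in> carrier (grp X (trm X a))\<rbrakk> \<Longrightarrow>
   elementary_homotopy X
     (XPath (ini X a) (k \<otimes>\<^bsub>grp X (ini X a)\<^esub> g) [(Fwd a, h)])
     (XPath (ini X a) k [(Fwd a, psi X a g \<otimes>\<^bsub>grp X (trm X a)\<^esub> h)])"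
| push_bwd:
  "\<lbrakk>a \<in> edges X; g \<in> carrier (grp X (trm X a)); h \<in> carrier (grp X (ini X a));
    k \<in> carrier (grp X (ini X a))\<rbrakk> \<Longrightarrow>
   elementary_homotopy X
     (XPath (trm X a) g [(Bwd a, h \<otimes>\<^bsub>grp X (ini X a)\<^esub> k)])
     (XPath (trm X a) (g \<otimes>\<^bsub>grp X (trm X a)\<^esub> psi X a h) [(Bwd a, k)])"
| cancel_fwd:
  "\<lbrakk>a \<in> edges X; g \<in> carrier (grp X (ini X a)); h \<in> carrier (grp X (ini X a));
    k \<in> carrier (grp X (ini X a))\<rbrakk> \<Longrightarrow>
   elementary_homotopy X
     (XPath (ini X a) g [(Fwd a, psi X a h), (Bwd a, k)])
     (XPath (ini X a) (g \<otimes>\<^bsub>grp X (ini X a)\<^esub> h \<otimes>\<^bsub>grp X (ini X a)\<^esub> k) [])"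
| cancel_bwd:
  "\<lbrakk>b \<in> edges X; g \<in> carrier (grp X (trm X b)); h \<in> carrier (grp X (ini X b));
    k \<in> carrier (grp X (trm X b))\<rbrakk> \<Longrightarrow>
   elementary_homotopy X
     (XPath (trm X b) g [(Bwd b, h), (Fwd b, k)])
     (XPath (trm X b) (g \<otimes>\<^bsub>grp X (trm X b)\<^esub> psi X b h \<otimes>\<^bsub>grp X (trm X b)\<^esub> k) [])"
| compose_fwd:
  "\<lbrakk>a \<in> edges X; b \<in> edges X; ini X a = trm X b;
    g \<in> carrier (grp X (ini X b)); k \<in> carrier (grp X (trm X a))\<rbrakk> \<Longrightarrow>
   elementary_homotopy X
     (XPath (ini X b) g [(Fwd b, \<one>\<^bsub>grp X (trm X b)\<^esub>), (Fwd a, k)])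
     (XPath (ini X b) g [(Fwd (cmp X a b),
        inv\<^bsub>grp X (trm X a)\<^esub> (twist X a b) \<otimes>\<^bsub>grp X (trm X a)\<^esub> k)])"
| compose_bwd:
  "\<lbrakk>a \<in> edges X; b \<in> edges X; ini X a = trm X b;
    g \<in> carrier (grp X (trm X a)); k \<in> carrier (grp X (ini X b))\<rbrakk> \<Longrightarrow>
   elementary_homotopy X
     (XPath (trm X a) g [(Bwd a, \<one>\<^bsub>grp X (ini X a)\<^esub>), (Bwd b, k)])
     (XPath (trm X a) (g \<otimes>\<^bsub>grp X (trm X a)\<^esub> twist X a b) [(Bwd (cmp X a b), k)])"

text \<open>
  Replacing a subpath \<open>p\<close> by \<open>q\<close> is expressed as passing from \<open>r \<star> p \<star> s\<close> to \<open>r \<star> q \<star> s\<close>.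
  The outermost group elements in the elementary homotopies are arbitrary, so this
  agrees with replacing a contiguous part of the tuple.
\<close>

inductive homotopy_step ::
  "('v, 'e, 'g) complex_of_groups \<Rightarrow> ('v, 'e, 'g) xpath \<Rightarrow> ('v, 'e, 'g) xpath \<Rightarrow> bool"
  for X where
  "\<lbrakk>elementary_homotopy X p q; is_xpath X r; is_xpath X s; xtrm X r = xini p; xtrm X p = xini s\<rbrakk> \<Longrightarrow>
   homotopy_step X (concat_path X (concat_path X r p) s) (concat_path X (concat_path X r q) s)"

definition homotopic ::
  "('v, 'e, 'g) complex_of_groups \<Rightarrow> ('v, 'e, 'g) xpath \<Rightarrow> ('v, 'e, 'g) xpath \<Rightarrow> bool" where
  "homotopic X = equivclp (homotopy_step X)"

definition homotopy_class ::
  "('v, 'e, 'g) complex_of_groups \<Rightarrow> ('v, 'e, 'g) xpath \<Rightarrow> ('v, 'e, 'g) xpath set" where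
  "homotopy_class X p = {q. homotopic X p q}"

text \<open>
  Here and below, an operation on classes defined through representatives is written as the union of
  the resulting classes over all representatives; when the operation is well defined,
  all members of this union coincide.
\<close>

definition fundamental_group ::
  "('v, 'e, 'g) complex_of_groups \<Rightarrow> 'v \<Rightarrow> ('v, 'e, 'g) xpath set monoid" where
  "fundamental_group X \<sigma> =
    \<lparr>carrier = homotopy_class X ` {p \<in> paths_from X \<sigma>. xtrm X p = \<sigma>},
     mult = (\<lambda>A B. \<Union>p\<in>A. \<Union>q\<in>B. homotopy_class X (concat_path X p q)),
     one = homotopy_class X (const_path \<sigma> \<one>\<^bsub>grp X \<sigma>\<^esub>)\<rparr>"

text \<open>
  Developability is taken to mean injectivity of the local groups into the fundamental groups, which
  is equivalent to being isomorphic to the complex of groups induced by some action on a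
  scwol; the latter would quantify over types.
\<close>

definition developable :: "('v, 'e, 'g) complex_of_groups \<Rightarrow> bool" where
  "developable X \<longleftrightarrow>
    (\<forall>\<sigma>\<in>verts X. inj_on (\<lambda>g. homotopy_class X (const_path \<sigma> g)) (carrier (grp X \<sigma>)))"


section \<open>The universal complex\<close>

definition path_class ::
  "('v, 'e, 'g) complex_of_groups \<Rightarrow> 'v \<Rightarrow> ('v, 'e, 'g) xpath \<Rightarrow> ('v, 'e, 'g) xpath set" where
  "path_class X \<sigma>0 p = {q \<in> paths_from X \<sigma>0. \<exists>g\<in>carrier (grp X (xtrm X p)).
    homotopy_class X q = homotopy_class X (concat_path X p (const_path (xtrm X p) g))}"

definition extend_class :: "('v, 'e, 'g) complex_of_groups \<Rightarrow> 'v
    \<Rightarrow> ('v, 'e, 'g) xpath set \<Rightarrow> 'e \<Rightarrow> ('v, 'e, 'g) xpath set" where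
  "extend_class X \<sigma>0 P a = (\<Union>p\<in>P. path_class X \<sigma>0 (concat_path X p (single_edge_path X a)))"

definition universal_scwol :: "('v, 'e, 'g) complex_of_groups \<Rightarrow> 'v
    \<Rightarrow> (('v, 'e, 'g) xpath set, ('v, 'e, 'g) xpath set \<times> 'e \<times> ('v, 'e, 'g) xpath set) scwol" where
  "universal_scwol X \<sigma>0 =
    \<lparr>verts = path_class X \<sigma>0 ` paths_from X \<sigma>0,
     edges = {(path_class X \<sigma>0 p, a, path_class X \<sigma>0 (concat_path X p (single_edge_path X a))) | p a.
       p \<in> paths_from X \<sigma>0 \<and> a \<in> edges X \<and> ini X a = xtrm X p},
     ini = (\<lambda>(P, a, Q). P),
     trm = (\<lambda>(P, a, Q). Q),
     cmp = (\<lambda>(_, a, _) (P, b, _). (P, cmp X a b, extend_class X \<sigma>0 P (cmp X a b)))\<rparr>"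

definition universal_actv :: "('v, 'e, 'g) complex_of_groups \<Rightarrow> 'v
    \<Rightarrow> ('v, 'e, 'g) xpath set \<Rightarrow> ('v, 'e, 'g) xpath set \<Rightarrow> ('v, 'e, 'g) xpath set" where
  "universal_actv X \<sigma>0 C P = (\<Union>q\<in>C. \<Union>p\<in>P. path_class X \<sigma>0 (concat_path X q p))"

definition universal_acte :: "('v, 'e, 'g) complex_of_groups \<Rightarrow> 'v \<Rightarrow> ('v, 'e, 'g) xpath set
    \<Rightarrow> ('v, 'e, 'g) xpath set \<times> 'e \<times> ('v, 'e, 'g) xpath set
    \<Rightarrow> ('v, 'e, 'g) xpath set \<times> 'e \<times> ('v, 'e, 'g) xpath set" where
  "universal_acte X \<sigma>0 C = (\<lambda>(P, a, _).
    (universal_actv X \<sigma>0 C P, a, extend_class X \<sigma>0 (universal_actv X \<sigma>0 C P) a))"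

end

theory Submission
  imports Defs
begin

text \<open>
  Write \<open>\<Gamma>\<close> for the fundamental group at \<open>\<sigma>0\<close>. The orbits of \<open>\<Gamma>\<close> on the universal complex
  correspond to the vertices and edges of \<open>X\<close>, by taking terminal vertices of paths. Choose a path
  \<open>p\<^sub>\<sigma>\<close> from \<open>\<sigma>0\<close> to \<open>\<sigma>\<close> in the class representing the orbit of \<open>\<sigma>\<close>. Its stabilizer consists of the
  classes \<open>\<phi>\<^sub>\<sigma>(g) = [p\<^sub>\<sigma> g p\<^sub>\<sigma>\<inverse>]\<close> with \<open>g\<close> in the local group at \<open>\<sigma>\<close>, and \<open>\<phi>\<^sub>\<sigma>\<close> is injective by
  developability. With \<open>A\<^sub>a = [p\<^sub>i\<^sub>(\<^sub>a\<^sub>) a p\<^sub>t\<^sub>(\<^sub>a\<^sub>)\<inverse>]\<close>, the elements \<open>\<phi>(a) = (h\<^sub>a A\<^sub>a)\<inverse>\<close> lie in the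
  stabilizer over \<open>t(a)\<close>, and together with the \<open>\<phi>\<^sub>\<sigma>\<close> they form the isomorphism; its
  axioms are the relations \<open>g a = a \<psi>\<^sub>a(g)\<close> and \<open>b a g\<^sub>a\<^sub>b = (ab)\<close> between paths up to homotopy.
\<close>

section \<open>Homotopy of paths\<close>

definition paths_between :: "('v, 'e, 'g) complex_of_groups \<Rightarrow> 'v \<Rightarrow> 'v \<Rightarrow> ('v, 'e, 'g) xpath set" where
  "paths_between X \<sigma> \<tau> = {p. is_xpath X p \<and> xini p = \<sigma> \<and> xtrm X p = \<tau>}"

lemma paths_between_Nil [simp]:
  "XPath \<rho> g [] \<in> paths_between X \<sigma> \<tau> \<longleftrightarrow>
    \<rho> = \<sigma> \<and> \<tau> = \<sigma> \<and> \<sigma> \<in> verts X \<and> g \<in> carrier (grp X \<sigma>)"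
  by (auto simp: paths_between_def is_xpath_def xtrm_def edge_path_end_def)

lemma paths_between_Cons [simp]:
  "XPath \<rho> g ((e, k) # s) \<in> paths_between X \<sigma> \<tau> \<longleftrightarrow>
    \<rho> = \<sigma> \<and> g \<in> carrier (grp X \<sigma>) \<and> oedge_in X e \<and> oini X e = \<sigma> \<and>
    XPath (otrm X e) k s \<in> paths_between X (otrm X e) \<tau>"
  by (auto simp: paths_between_def is_xpath_def xtrm_def edge_path_end_def)

lemma xtrm_eq: "p \<in> paths_between X \<sigma> \<tau> \<Longrightarrow> xtrm X p = \<tau>"
  by (simp add: paths_between_def)

lemma xini_eq: "p \<in> paths_between X \<sigma> \<tau> \<Longrightarrow> xini p = \<sigma>"
  by (simp add: paths_between_def)

lemma xhead_closed: "p \<in> paths_between X \<sigma> \<tau> \<Longrightarrow> xhead p \<in> carrier (grp X \<sigma>)"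
  by (auto simp: paths_between_def is_xpath_def)

lemma paths_from_iff: "p \<in> paths_from X \<sigma> \<longleftrightarrow> (\<exists>\<tau>. p \<in> paths_between X \<sigma> \<tau>)"
  by (simp add: paths_from_def paths_between_def)

lemma paths_between_from: "p \<in> paths_between X \<sigma> \<tau> \<Longrightarrow> p \<in> paths_from X \<sigma>"
  by (simp add: paths_from_def paths_between_def)

section \<open>Homotopy as an equivalence relation\<close>

lemma homotopic_refl: "homotopic X p p"
  by (simp add: homotopic_def)

lemma homotopic_sym: "homotopic X p q \<Longrightarrow> homotopic X q p"
  unfolding homotopic_def by (rule equivclp_sym)

lemma homotopic_trans: "homotopic X p q \<Longrightarrow> homotopic X q r \<Longrightarrow> homotopic X p r"
  unfolding homotopic_def by (rule equivclp_trans)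

lemma homotopy_class_eq_iff: "homotopy_class X p = homotopy_class X q \<longleftrightarrow> homotopic X p q"
proof
  assume "homotopy_class X p = homotopy_class X q"
  moreover have "q \<in> homotopy_class X q" by (simp add: homotopy_class_def homotopic_refl)
  ultimately have "q \<in> homotopy_class X p" by simp
  then show "homotopic X p q" by (simp add: homotopy_class_def)
next
  assume "homotopic X p q"
  then have "homotopic X p r \<longleftrightarrow> homotopic X q r" for r
    by (meson homotopic_sym homotopic_trans)
  then show "homotopy_class X p = homotopy_class X q" by (simp add: homotopy_class_def)
qed

text \<open>Symmetry and transitivity are separate cases, so an invariant of homotopy has real
  content only for a single step.\<close>

lemma homotopic_induct [consumes 1, case_names step refl sym trans]:
  assumes "homotopic X p q"
    and "\<And>p q. homotopy_step X p q \<Longrightarrow> R p q"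
    and "\<And>p. R p p" "\<And>p q. R p q \<Longrightarrow> R q p" "\<And>p q r. R p q \<Longrightarrow> R q r \<Longrightarrow> R p r"
  shows "R p q"
  using assms(1) unfolding homotopic_def
proof (induction rule: equivclp_induct)
  case base
  then show ?case by (rule assms(3))
next
  case (step y z)
  then show ?case using assms(2,4,5) by blast
qed

text \<open>Extends \<open>single_edge_path\<close> to formal inverses of edges, which are needed to
  invert paths.\<close>

definition edge_xpath :: "('v, 'e, 'g) complex_of_groups \<Rightarrow> 'e oedge \<Rightarrow> ('v, 'e, 'g) xpath" where
  "edge_xpath X e = XPath (oini X e) \<one>\<^bsub>grp X (oini X e)\<^esub> [(e, \<one>\<^bsub>grp X (otrm X e)\<^esub>)]"

lemma single_edge_path_eq: "single_edge_path X a = edge_xpath X (Fwd a)"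
  by (simp add: single_edge_path_def edge_xpath_def)

context complex_of_groups
begin

abbreviation concat_xpath (infixl "\<star>" 70) where "p \<star> q \<equiv> concat_path X p q"
abbreviation Paths where "Paths \<equiv> paths_between X"
abbreviation "cls \<equiv> homotopy_class X"

lemma oini_closed [simp]: "oedge_in X e \<Longrightarrow> oini X e \<in> verts X"
  by (cases e) (auto simp: ini_closed trm_closed)

lemma otrm_closed [simp]: "oedge_in X e \<Longrightarrow> otrm X e \<in> verts X"
  by (cases e) (auto simp: ini_closed trm_closed)

lemma Paths_verts:
  assumes "p \<in> Paths \<sigma> \<tau>"
  shows "\<sigma> \<in> verts X" "\<tau> \<in> verts X"
proof -
  have "XPath \<rho> g s \<in> Paths \<sigma> \<tau> \<Longrightarrow> \<sigma> \<in> verts X \<and> \<tau> \<in> verts X" for \<rho> g s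
    by (induction s arbitrary: \<rho> g \<sigma>) (auto 4 4)
  then show "\<sigma> \<in> verts X" "\<tau> \<in> verts X" using assms by (cases p; blast)+
qed

lemma group_at [simp]: "\<sigma> \<in> verts X \<Longrightarrow> group (grp X \<sigma>)"
  by (rule group_grp)

lemma monoid_at [simp]: "\<sigma> \<in> verts X \<Longrightarrow> monoid (grp X \<sigma>)"
  using group_grp group.is_monoid by blast

lemma mult_at_closed [simp]:
  "\<sigma> \<in> verts X \<Longrightarrow> g \<in> carrier (grp X \<sigma>) \<Longrightarrow> k \<in> carrier (grp X \<sigma>) \<Longrightarrow>
    g \<otimes>\<^bsub>grp X \<sigma>\<^esub> k \<in> carrier (grp X \<sigma>)"
  by (simp add: monoid.m_closed)

lemma one_at_closed [simp]: "\<sigma> \<in> verts X \<Longrightarrow> \<one>\<^bsub>grp X \<sigma>\<^esub> \<in> carrier (grp X \<sigma>)"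
  by (simp add: monoid.one_closed)

lemma inv_at_closed [simp]:
  "\<sigma> \<in> verts X \<Longrightarrow> g \<in> carrier (grp X \<sigma>) \<Longrightarrow> inv\<^bsub>grp X \<sigma>\<^esub> g \<in> carrier (grp X \<sigma>)"
  by (simp add: group.inv_closed)

lemma one_mult_at [simp]:
  "\<sigma> \<in> verts X \<Longrightarrow> g \<in> carrier (grp X \<sigma>) \<Longrightarrow> \<one>\<^bsub>grp X \<sigma>\<^esub> \<otimes>\<^bsub>grp X \<sigma>\<^esub> g = g"
  "\<sigma> \<in> verts X \<Longrightarrow> g \<in> carrier (grp X \<sigma>) \<Longrightarrow> g \<otimes>\<^bsub>grp X \<sigma>\<^esub> \<one>\<^bsub>grp X \<sigma>\<^esub> = g"
  by (simp_all add: monoid.l_one monoid.r_one)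

lemma inv_mult_at [simp]:
  "\<sigma> \<in> verts X \<Longrightarrow> g \<in> carrier (grp X \<sigma>) \<Longrightarrow> inv\<^bsub>grp X \<sigma>\<^esub> g \<otimes>\<^bsub>grp X \<sigma>\<^esub> g = \<one>\<^bsub>grp X \<sigma>\<^esub>"
  "\<sigma> \<in> verts X \<Longrightarrow> g \<in> carrier (grp X \<sigma>) \<Longrightarrow> g \<otimes>\<^bsub>grp X \<sigma>\<^esub> inv\<^bsub>grp X \<sigma>\<^esub> g = \<one>\<^bsub>grp X \<sigma>\<^esub>"
  by (simp_all add: group.l_inv group.r_inv)

lemma psi_closed [simp]:
  "a \<in> edges X \<Longrightarrow> g \<in> carrier (grp X (ini X a)) \<Longrightarrow> psi X a g \<in> carrier (grp X (trm X a))"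
  using psi_hom by (auto simp: hom_def)

lemma psi_one [simp]:
  "a \<in> edges X \<Longrightarrow> psi X a \<one>\<^bsub>grp X (ini X a)\<^esub> = \<one>\<^bsub>grp X (trm X a)\<^esub>"
  by (rule hom_one[OF psi_hom]) (auto simp: ini_closed trm_closed)

declare ini_closed [simp] trm_closed [simp] cmp_closed [simp] ini_cmp [simp] trm_cmp [simp]
  twist_closed [simp]

section \<open>Concatenation, strictly associative and with strict units\<close>

lemma concat_Nil_closed:
  assumes "g \<in> carrier (grp X \<sigma>)" and "q \<in> Paths \<sigma> \<rho>"
  shows "XPath \<sigma> g [] \<star> q \<in> Paths \<sigma> \<rho>"
proof -
  obtain k s where "q = XPath \<sigma> k s"
    using assms(2) by (cases q) (auto simp: paths_between_def)
  then show ?thesis using assms Paths_verts[OF assms(2)] by (cases s) auto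
qed

text \<open>\<open>concat_path\<close> takes the recursive result apart into head and steps; this
  puts it together again, once its initial vertex is known.\<close>

lemma xpath_collapse: "xini p = \<sigma> \<Longrightarrow> XPath \<sigma> (xhead p) (xsteps p) = p"
  by (cases p) auto

lemma concat_closed [intro, simp]:
  assumes "p \<in> Paths \<sigma> \<tau>" and "q \<in> Paths \<tau> \<rho>"
  shows "p \<star> q \<in> Paths \<sigma> \<rho>"
proof -
  have "XPath \<upsilon> g s \<in> Paths \<sigma> \<tau> \<Longrightarrow> XPath \<upsilon> g s \<star> q \<in> Paths \<sigma> \<rho>" for \<upsilon> g s
  proof (induction s arbitrary: \<upsilon> g \<sigma>)
    case Nil
    then show ?case using assms(2) concat_Nil_closed by (simp del: concat_path.simps)
  next
    case (Cons x s)
    obtain e k where x: "x = (e, k)" by force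
    have "XPath (otrm X e) k s \<star> q \<in> Paths (otrm X e) \<rho>"
      using Cons unfolding x by simp
    then show ?case using Cons.prems by (simp add: x Let_def xpath_collapse[OF xini_eq])
  qed
  then show ?thesis using assms(1) by (cases p) blast
qed

text \<open>An equality of paths, not merely up to homotopy. Associativity of a local group enters
  only when \<open>q\<close> has length zero, because only then do three group elements meet at one
  vertex.\<close>

lemma concat_assoc:
  assumes "p \<in> Paths \<sigma> \<tau>" and "q \<in> Paths \<tau> \<rho>" and "r \<in> Paths \<rho> \<upsilon>"
  shows "p \<star> q \<star> r = p \<star> (q \<star> r)"
proof -
  have "XPath \<alpha> g s \<in> Paths \<sigma> \<tau> \<Longrightarrow> XPath \<alpha> g s \<star> q \<star> r = XPath \<alpha> g s \<star> (q \<star> r)" for \<alpha> g s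
  proof (induction s arbitrary: \<alpha> g \<sigma>)
    case Nil
    obtain k s where q: "q = XPath \<tau> k s" using assms(2) by (cases q) (auto simp: paths_between_def)
    show ?case
    proof (cases s)
      case Nil': Nil
      then show ?thesis
        using Nil assms q xhead_closed[OF assms(3)] by (auto simp: monoid.m_assoc)
    next
      case (Cons x s)
      then show ?thesis
        using Nil q by (cases x) (auto simp: Let_def)
    qed
  next
    case (Cons x s)
    obtain e k where x: "x = (e, k)" by force
    let ?p = "XPath (otrm X e) k s"
    have p: "?p \<in> Paths (otrm X e) \<tau>" using Cons.prems by (simp add: x)
    have "?p \<star> q \<star> r = ?p \<star> (q \<star> r)" using Cons.IH[OF p] .
    moreover have "xini (?p \<star> q) = otrm X e" using xini_eq[OF concat_closed[OF p assms(2)]] .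
    ultimately show ?case using Cons.prems by (simp add: x Let_def xpath_collapse)
  qed
  then show ?thesis using assms(1) by (cases p) blast
qed

lemma const_path_closed [simp]:
  "\<sigma> \<in> verts X \<Longrightarrow> g \<in> carrier (grp X \<sigma>) \<Longrightarrow> const_path \<sigma> g \<in> Paths \<sigma> \<sigma>"
  by (simp add: const_path_def)

lemma one_concat [simp]:
  assumes "p \<in> Paths \<sigma> \<tau>"
  shows "const_path \<sigma> \<one>\<^bsub>grp X \<sigma>\<^esub> \<star> p = p"
  using Paths_verts[OF assms] xhead_closed[OF assms] xini_eq[OF assms]
  by (simp add: const_path_def xpath_collapse)

lemma concat_one [simp]:
  assumes "p \<in> Paths \<sigma> \<tau>"
  shows "p \<star> const_path \<tau> \<one>\<^bsub>grp X \<tau>\<^esub> = p"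
proof -
  have "XPath \<alpha> g s \<in> Paths \<sigma> \<tau> \<Longrightarrow> XPath \<alpha> g s \<star> const_path \<tau> \<one>\<^bsub>grp X \<tau>\<^esub> = XPath \<alpha> g s"
    for \<alpha> g s
  proof (induction s arbitrary: \<alpha> g \<sigma>)
    case Nil
    then show ?case by (auto simp: const_path_def)
  next
    case (Cons x s)
    then show ?case by (cases x) (auto simp: Let_def)
  qed
  then show ?thesis using assms by (cases p) blast
qed

lemma const_concat:
  "const_path \<sigma> g \<star> const_path \<sigma> k = const_path \<sigma> (g \<otimes>\<^bsub>grp X \<sigma>\<^esub> k)"
  by (simp add: const_path_def)

section \<open>Compatibility of homotopy with concatenation\<close>

lemma elementary_homotopy_closed:
  assumes "elementary_homotopy X p q"
  shows "p \<in> Paths (xini p) (xtrm X p) \<and> q \<in> Paths (xini p) (xtrm X p)"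
  using assms
  by cases (auto simp: xtrm_def edge_path_end_def)

text \<open>All conditions on the pieces become membership in \<open>Paths\<close>, the form in
  which closure and associativity of concatenation apply.\<close>

lemma homotopy_step_iff:
  "homotopy_step X p q \<longleftrightarrow> (\<exists>p' q' r s \<sigma> \<tau>. elementary_homotopy X p' q' \<and>
    p' \<in> Paths \<sigma> \<tau> \<and> q' \<in> Paths \<sigma> \<tau> \<and> r \<in> Paths (xini r) \<sigma> \<and> s \<in> Paths \<tau> (xtrm X s) \<and>
    p = r \<star> p' \<star> s \<and> q = r \<star> q' \<star> s)" (is "?L \<longleftrightarrow> ?R")
proof
  assume ?L
  then obtain p' q' r s where *: "elementary_homotopy X p' q'" "is_xpath X r" "is_xpath X s"
    "xtrm X r = xini p'" "xtrm X p' = xini s" "p = r \<star> p' \<star> s" "q = r \<star> q' \<star> s"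
    by cases
  moreover have "r \<in> Paths (xini r) (xini p')" "s \<in> Paths (xtrm X p') (xtrm X s)"
    using * by (simp_all add: paths_between_def)
  ultimately show ?R using elementary_homotopy_closed[OF *(1)] by metis
next
  assume ?R
  then show ?L by (auto simp: paths_between_def intro!: homotopy_step.intros)
qed

lemma homotopy_step_closed:
  assumes "homotopy_step X p q"
  obtains \<sigma> \<tau> where "p \<in> Paths \<sigma> \<tau>" "q \<in> Paths \<sigma> \<tau>"
  using assms unfolding homotopy_step_iff by blast

lemma homotopic_closed:
  assumes "homotopic X p q"
  shows "p \<in> Paths \<sigma> \<tau> \<longleftrightarrow> q \<in> Paths \<sigma> \<tau>"
  using assms
proof (induction rule: homotopic_induct)
  case (step p q)
  then show ?case
    by (elim homotopy_step_closed) (metis xini_eq xtrm_eq)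
qed auto

lemma homotopic_concat:
  assumes "homotopic X p q" and "p \<in> Paths \<sigma> \<tau>" and "r \<in> Paths \<rho> \<sigma>" and "s \<in> Paths \<tau> \<upsilon>"
  shows "homotopic X (r \<star> p \<star> s) (r \<star> q \<star> s)"
proof -
  \<comment> \<open>The endpoint condition sits inside the induction claim, next to the homotopy
    itself: in the symmetric and transitive cases it is transferred to the other path by
    \<open>homotopic_closed\<close>.\<close>
  have "homotopic X p q \<and> (p \<in> Paths \<sigma> \<tau> \<longrightarrow> homotopic X (r \<star> p \<star> s) (r \<star> q \<star> s))"
    using assms(1)
  proof (induction rule: homotopic_induct)
    case (step p q)
    have "homotopic X (r \<star> p \<star> s) (r \<star> q \<star> s)" if p: "p \<in> Paths \<sigma> \<tau>"
    proof -
      obtain p' q' r' s' \<sigma>' \<tau>' where *: "elementary_homotopy X p' q'"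
        "p' \<in> Paths \<sigma>' \<tau>'" "q' \<in> Paths \<sigma>' \<tau>'" "r' \<in> Paths (xini r') \<sigma>'" "s' \<in> Paths \<tau>' (xtrm X s')"
        "p = r' \<star> p' \<star> s'" "q = r' \<star> q' \<star> s'"
        using step unfolding homotopy_step_iff by blast
      have "p \<in> Paths (xini r') (xtrm X s')" unfolding * using *(2,4,5) by (meson concat_closed)
      then have ends: "xini r' = \<sigma>" "xtrm X s' = \<tau>" using p by (metis xini_eq xtrm_eq)+
      have r': "r' \<in> Paths \<sigma> \<sigma>'" and s': "s' \<in> Paths \<tau>' \<tau>" using * ends by auto
      \<comment> \<open>The outer context \<open>r\<close>, \<open>s\<close> is absorbed into the
        context of the step, so the enlarged pair is again a single step.\<close>
      have eq: "r \<star> (r' \<star> x \<star> s') \<star> s = (r \<star> r') \<star> x \<star> (s' \<star> s)" if x: "x \<in> Paths \<sigma>' \<tau>'" for x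
      proof -
        have "r \<star> (r' \<star> x \<star> s') \<star> s = r \<star> (r' \<star> x) \<star> s' \<star> s"
          by (subst concat_assoc[OF assms(3) concat_closed[OF r' x] s']) (rule refl)
        also have "\<dots> = r \<star> r' \<star> x \<star> s' \<star> s"
          by (subst concat_assoc[OF assms(3) r' x]) (rule refl)
        also have "\<dots> = r \<star> r' \<star> x \<star> (s' \<star> s)"
          by (rule concat_assoc[OF concat_closed[OF concat_closed[OF assms(3) r'] x] s' assms(4)])
        finally show ?thesis .
      qed
      have rr: "r \<star> r' \<in> Paths \<rho> \<sigma>'" and ss: "s' \<star> s \<in> Paths \<tau>' \<upsilon>"
        using r' s' assms(3,4) by (meson concat_closed)+
      have "homotopy_step X (r \<star> p \<star> s) (r \<star> q \<star> s)"
        unfolding homotopy_step_iff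
        using *(1-3) rr ss xini_eq[OF rr] xtrm_eq[OF ss] eq[OF *(2)] eq[OF *(3)] *(6,7) by metis
      then show ?thesis
        unfolding homotopic_def by (rule r_into_equivclp)
    qed
    moreover have "homotopic X p q" using step unfolding homotopic_def by (rule r_into_equivclp)
    ultimately show ?case by blast
  next
    case (refl p)
    then show ?case by (simp add: homotopic_refl)
  next
    case (sym p q)
    then show ?case by (meson homotopic_closed homotopic_sym)
  next
    case (trans p q t)
    then show ?case by (meson homotopic_closed homotopic_trans)
  qed
  then show ?thesis using assms(2) by blast
qed

text \<open>One factor is changed at a time; the free side of the context is filled with a constant
  identity path.\<close>

lemma cls_concat:
  assumes "cls p = cls p'" and "cls q = cls q'" and "p \<in> Paths \<sigma> \<tau>" and "q \<in> Paths \<tau> \<rho>"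
  shows "cls (p \<star> q) = cls (p' \<star> q')"
proof -
  have hom: "homotopic X p p'" "homotopic X q q'" using assms(1,2) by (simp_all add: homotopy_class_eq_iff)
  have p': "p' \<in> Paths \<sigma> \<tau>" and q': "q' \<in> Paths \<tau> \<rho>"
    using homotopic_closed hom assms(3,4) by blast+
  note v = Paths_verts[OF assms(3)] Paths_verts[OF assms(4)]
  have "homotopic X (p \<star> q) (p' \<star> q)"
    using homotopic_concat[OF hom(1) assms(3) const_path_closed[OF v(1) one_at_closed[OF v(1)]] assms(4)]
      assms(3) p' by simp
  moreover have "homotopic X (p' \<star> q) (p' \<star> q')"
    using homotopic_concat[OF hom(2) assms(4) p' const_path_closed[OF v(4) one_at_closed[OF v(4)]]]
      concat_one[OF concat_closed[OF p' assms(4)]] concat_one[OF concat_closed[OF p' q']] by simp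
  ultimately show ?thesis unfolding homotopy_class_eq_iff by (rule homotopic_trans)
qed

text \<open>Constant identity paths are strict units, so an elementary homotopy is a step in a
  trivial context.\<close>

lemma cls_elementary:
  assumes "elementary_homotopy X p q"
  shows "cls p = cls q"
proof -
  let ?\<sigma> = "xini p" and ?\<tau> = "xtrm X p"
  have p: "p \<in> Paths ?\<sigma> ?\<tau>" and q: "q \<in> Paths ?\<sigma> ?\<tau>"
    using elementary_homotopy_closed[OF assms] by auto
  note v = Paths_verts[OF p]
  have "const_path ?\<sigma> \<one>\<^bsub>grp X ?\<sigma>\<^esub> \<star> x \<star> const_path ?\<tau> \<one>\<^bsub>grp X ?\<tau>\<^esub> = x"
    if "x \<in> Paths ?\<sigma> ?\<tau>" for x
    using one_concat[OF that] concat_one[OF that] by simp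
  then have eq: "p = const_path ?\<sigma> \<one>\<^bsub>grp X ?\<sigma>\<^esub> \<star> p \<star> const_path ?\<tau> \<one>\<^bsub>grp X ?\<tau>\<^esub>"
    "q = const_path ?\<sigma> \<one>\<^bsub>grp X ?\<sigma>\<^esub> \<star> q \<star> const_path ?\<tau> \<one>\<^bsub>grp X ?\<tau>\<^esub>"
    using p q by simp_all
  have cp: "const_path \<rho> \<one>\<^bsub>grp X \<rho>\<^esub> \<in> Paths \<rho> \<rho>" if "\<rho> \<in> verts X" for \<rho>
    using that by simp
  have "homotopy_step X p q"
    unfolding homotopy_step_iff
    using assms p q cp[OF v(1)] cp[OF v(2)] xini_eq[OF cp[OF v(1)]] xtrm_eq[OF cp[OF v(2)]] eq
    by metis
  then show ?thesis unfolding homotopy_class_eq_iff homotopic_def by (rule r_into_equivclp)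
qed

section \<open>Relations and inverses in the fundamental groupoid\<close>

lemma edge_xpath_closed [simp]:
  "oedge_in X e \<Longrightarrow> edge_xpath X e \<in> Paths (oini X e) (otrm X e)"
  by (simp add: edge_xpath_def)

lemma edge_xpath_Fwd_closed [simp]:
  "a \<in> edges X \<Longrightarrow> edge_xpath X (Fwd a) \<in> Paths (ini X a) (trm X a)"
  using edge_xpath_closed[of "Fwd a"] by simp

text \<open>The case of \<open>push_fwd\<close> in which the two outer group elements are
  trivial.\<close>

lemma cls_const_edge:
  assumes "a \<in> edges X" and "g \<in> carrier (grp X (ini X a))"
  shows "cls (const_path (ini X a) g \<star> edge_xpath X (Fwd a)) =
    cls (edge_xpath X (Fwd a) \<star> const_path (trm X a) (psi X a g))"
  using cls_elementary[OF push_fwd[OF assms(1) _ assms(2), of "\<one>\<^bsub>grp X (ini X a)\<^esub>" "\<one>\<^bsub>grp X (trm X a)\<^esub>"]]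
    assms
  by (simp add: const_path_def edge_xpath_def)

text \<open>Taking \<open>twist X a b\<close> as the last element in \<open>compose_fwd\<close>
  cancels the inverse twist on the composite edge.\<close>

lemma cls_edge_cmp:
  assumes "a \<in> edges X" "b \<in> edges X" "ini X a = trm X b"
  shows "cls (edge_xpath X (Fwd b) \<star> edge_xpath X (Fwd a) \<star> const_path (trm X a) (twist X a b)) =
    cls (edge_xpath X (Fwd (cmp X a b)))"
  using cls_elementary[OF compose_fwd[OF assms, of "\<one>\<^bsub>grp X (ini X b)\<^esub>" "twist X a b"]] assms
    trm_closed[OF assms(1)] trm_closed[OF assms(2)]
  by (simp add: const_path_def edge_xpath_def)

lemma cls_edge_cancel:
  assumes "a \<in> edges X"
  shows "cls (edge_xpath X (Fwd a) \<star> edge_xpath X (Bwd a)) = cls (const_path (ini X a) \<one>\<^bsub>grp X (ini X a)\<^esub>)"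
    "cls (edge_xpath X (Bwd a) \<star> edge_xpath X (Fwd a)) = cls (const_path (trm X a) \<one>\<^bsub>grp X (trm X a)\<^esub>)"
proof -
  show "cls (edge_xpath X (Fwd a) \<star> edge_xpath X (Bwd a)) = cls (const_path (ini X a) \<one>\<^bsub>grp X (ini X a)\<^esub>)"
    using cls_elementary[OF cancel_fwd[OF assms, of "\<one>\<^bsub>grp X (ini X a)\<^esub>" "\<one>\<^bsub>grp X (ini X a)\<^esub>" "\<one>\<^bsub>grp X (ini X a)\<^esub>"]]
      assms
    by (simp add: const_path_def edge_xpath_def)
  show "cls (edge_xpath X (Bwd a) \<star> edge_xpath X (Fwd a)) = cls (const_path (trm X a) \<one>\<^bsub>grp X (trm X a)\<^esub>)"
    using cls_elementary[OF cancel_bwd[OF assms, of "\<one>\<^bsub>grp X (trm X a)\<^esub>" "\<one>\<^bsub>grp X (ini X a)\<^esub>" "\<one>\<^bsub>grp X (trm X a)\<^esub>"]]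
      assms
    by (simp add: const_path_def edge_xpath_def)
qed

text \<open>Two-sided inverses in the fundamental groupoid, recorded as a relation between
  representing paths together with their endpoints.\<close>

definition inverse_path where
  "inverse_path \<sigma> \<tau> p q \<longleftrightarrow> p \<in> Paths \<sigma> \<tau> \<and> q \<in> Paths \<tau> \<sigma> \<and>
    cls (p \<star> q) = cls (const_path \<sigma> \<one>\<^bsub>grp X \<sigma>\<^esub>) \<and> cls (q \<star> p) = cls (const_path \<tau> \<one>\<^bsub>grp X \<tau>\<^esub>)"

lemma inverse_path_concat:
  assumes "inverse_path \<sigma> \<tau> p p'" and "inverse_path \<tau> \<rho> q q'"
  shows "inverse_path \<sigma> \<rho> (p \<star> q) (q' \<star> p')"
proof -
  \<comment> \<open>Stated for arbitrary paths, so that the other composite follows by exchanging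
    each path with its inverse.\<close>
  have *: "cls (p \<star> q \<star> (q' \<star> p')) = cls (const_path \<sigma> \<one>\<^bsub>grp X \<sigma>\<^esub>)"
    if "inverse_path \<sigma> \<tau> p p'" "inverse_path \<tau> \<rho> q q'" for \<sigma> \<tau> \<rho> p p' q q'
  proof -
    have p: "p \<in> Paths \<sigma> \<tau>" "p' \<in> Paths \<tau> \<sigma>" and q: "q \<in> Paths \<tau> \<rho>" "q' \<in> Paths \<rho> \<tau>"
      using that by (auto simp: inverse_path_def)
    have "p \<star> q \<star> (q' \<star> p') = p \<star> (q \<star> q' \<star> p')"
      using concat_assoc[OF p(1) q(1) concat_closed[OF q(2) p(2)]] concat_assoc[OF q p(2)] by simp
    also have "cls \<dots> = cls (p \<star> (const_path \<tau> \<one>\<^bsub>grp X \<tau>\<^esub> \<star> p'))"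
      using that p q by (intro cls_concat[of _ _ _ _ \<sigma> \<tau> \<sigma>] cls_concat[of _ _ _ _ \<tau> \<tau> \<sigma>])
        (auto simp: inverse_path_def)
    also have "\<dots> = cls (const_path \<sigma> \<one>\<^bsub>grp X \<sigma>\<^esub>)"
      using that by (auto simp: inverse_path_def)
    finally show ?thesis .
  qed
  have "inverse_path \<tau> \<sigma> p' p" "inverse_path \<rho> \<tau> q' q"
    using assms by (auto simp: inverse_path_def)
  then show ?thesis using *[OF assms] * assms unfolding inverse_path_def by (auto; blast)
qed

text \<open>Every path is a concatenation of constant paths and single oriented edges. The former
  are inverted in the local groups, the latter by the formal inverse edge.\<close>

lemma inverse_path_exists:
  assumes "p \<in> Paths \<sigma> \<tau>"
  shows "\<exists>q. inverse_path \<sigma> \<tau> p q"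
proof -
  have const: "inverse_path \<sigma> \<sigma> (const_path \<sigma> g) (const_path \<sigma> (inv\<^bsub>grp X \<sigma>\<^esub> g))"
    if "\<sigma> \<in> verts X" "g \<in> carrier (grp X \<sigma>)" for \<sigma> g
    using that by (simp add: inverse_path_def const_concat)
  have edge: "\<exists>e'. inverse_path (oini X e) (otrm X e) (edge_xpath X e) (edge_xpath X e')"
    if "oedge_in X e" for e
  proof (cases e)
    case (Fwd a)
    then show ?thesis
      using that cls_edge_cancel[of a] edge_xpath_closed[of "Bwd a"]
      by (intro exI[of _ "Bwd a"]) (simp add: inverse_path_def)
  next
    case (Bwd a)
    then show ?thesis
      using that cls_edge_cancel[of a] edge_xpath_closed[of "Bwd a"]
      by (intro exI[of _ "Fwd a"]) (simp add: inverse_path_def)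
  qed
  have "XPath \<upsilon> g s \<in> Paths \<sigma> \<tau> \<Longrightarrow> \<exists>q. inverse_path \<sigma> \<tau> (XPath \<upsilon> g s) q" for \<upsilon> g s
  proof (induction s arbitrary: \<upsilon> g \<sigma>)
    case Nil
    then show ?case using const[of \<sigma> g] by (auto simp: const_path_def)
  next
    case (Cons x s)
    obtain e k where x: "x = (e, k)" by force
    let ?p = "XPath (otrm X e) k s"
    have e: "oedge_in X e" "oini X e = \<sigma>" and p: "?p \<in> Paths (otrm X e) \<tau>"
      and g: "g \<in> carrier (grp X \<sigma>)" "\<sigma> \<in> verts X"
      using Cons.prems by (auto simp: x)
    obtain q e' where "inverse_path (otrm X e) \<tau> ?p q"
      "inverse_path \<sigma> (otrm X e) (edge_xpath X e) (edge_xpath X e')"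
      using Cons.IH[OF p] edge[OF e(1)] e(2) by auto
    then have "\<exists>q. inverse_path \<sigma> \<tau> (const_path \<sigma> g \<star> (edge_xpath X e \<star> ?p)) q"
      using const[OF g(2,1)] inverse_path_concat by blast
    moreover have "const_path \<sigma> g \<star> (edge_xpath X e \<star> ?p) = XPath \<upsilon> g (x # s)"
      using Cons.prems e g xhead_closed[OF p] by (simp add: x const_path_def edge_xpath_def Let_def)
    ultimately show ?case by simp
  qed
  then show ?thesis using assms by (cases p) blast
qed

text \<open>An edge path becomes a path in the complex of groups by inserting identity elements
  everywhere.\<close>

lemma connected_path_exists:
  assumes "connected_scwol X" and "\<sigma> \<in> verts X" and "\<tau> \<in> verts X"
  shows "\<exists>p. p \<in> Paths \<sigma> \<tau>"
proof -
  obtain es where es: "edge_path X \<sigma> es" "edge_path_end X \<sigma> es = \<tau>"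
    using assms unfolding connected_scwol_def by blast
  let ?p = "XPath \<sigma> \<one>\<^bsub>grp X \<sigma>\<^esub> (map (\<lambda>e. (e, \<one>\<^bsub>grp X (otrm X e)\<^esub>)) es)"
  have "edge_path X \<sigma> es \<Longrightarrow> e \<in> set es \<Longrightarrow> oedge_in X e" for e
    by (induction es arbitrary: \<sigma>) auto
  then have "?p \<in> Paths \<sigma> \<tau>"
    using es assms(2) by (auto simp: paths_between_def is_xpath_def xtrm_def comp_def)
  then show ?thesis by blast
qed


section \<open>The fundamental group and the universal complex\<close>

lemma self_mem_cls: "p \<in> cls p"
  by (simp add: homotopy_class_def homotopic_refl)

lemma mem_clsD: "q \<in> cls p \<Longrightarrow> cls q = cls p"
  unfolding homotopy_class_eq_iff by (simp add: homotopy_class_def homotopic_sym)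

lemma mem_cls_closed: "q \<in> cls p \<Longrightarrow> p \<in> Paths \<sigma> \<tau> \<Longrightarrow> q \<in> Paths \<sigma> \<tau>"
  using homotopic_closed by (auto simp: homotopy_class_def)

lemma cls_closed: "cls p = cls q \<Longrightarrow> p \<in> Paths \<sigma> \<tau> \<Longrightarrow> q \<in> Paths \<sigma> \<tau>"
  using homotopic_closed by (auto simp: homotopy_class_eq_iff)

lemma carrier_fundamental_group:
  "carrier (fundamental_group X \<sigma>) = cls ` Paths \<sigma> \<sigma>"
  by (auto simp: fundamental_group_def paths_from_def paths_between_def)

text \<open>By \<open>cls_concat\<close> the union defining the product runs over copies of one
  class.\<close>

lemma mult_fundamental_group:
  assumes "p \<in> Paths \<sigma> \<sigma>" and "q \<in> Paths \<sigma> \<sigma>"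
  shows "cls p \<otimes>\<^bsub>fundamental_group X \<sigma>\<^esub> cls q = cls (p \<star> q)"
proof -
  have "cls (p' \<star> q') = cls (p \<star> q)" if "p' \<in> cls p" "q' \<in> cls q" for p' q'
    using cls_concat[OF mem_clsD[OF that(1)] mem_clsD[OF that(2)]] mem_cls_closed that assms by blast
  moreover have "cls p \<noteq> {}" "cls q \<noteq> {}" using self_mem_cls by blast+
  ultimately show ?thesis by (auto simp: fundamental_group_def)
qed

lemma one_fundamental_group:
  "\<one>\<^bsub>fundamental_group X \<sigma>\<^esub> = cls (const_path \<sigma> \<one>\<^bsub>grp X \<sigma>\<^esub>)"
  by (simp add: fundamental_group_def)

lemma group_fundamental_group:
  assumes "\<sigma> \<in> verts X"
  shows "group (fundamental_group X \<sigma>)"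
proof (rule groupI)
  fix A assume "A \<in> carrier (fundamental_group X \<sigma>)"
  then obtain p where p: "p \<in> Paths \<sigma> \<sigma>" "A = cls p" by (auto simp: carrier_fundamental_group)
  obtain q where q: "inverse_path \<sigma> \<sigma> p q" using inverse_path_exists[OF p(1)] by blast
  then have "q \<in> Paths \<sigma> \<sigma>" by (simp add: inverse_path_def)
  then show "\<exists>B\<in>carrier (fundamental_group X \<sigma>). B \<otimes>\<^bsub>fundamental_group X \<sigma>\<^esub> A = \<one>\<^bsub>fundamental_group X \<sigma>\<^esub>"
    using p q by (intro bexI[of _ "cls q"])
      (auto simp: mult_fundamental_group one_fundamental_group carrier_fundamental_group inverse_path_def)
qed (use assms in \<open>auto simp: carrier_fundamental_group mult_fundamental_group one_fundamental_group
      concat_assoc[of _ \<sigma> \<sigma> _ \<sigma> _ \<sigma>]\<close>)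

section \<open>Vertices and edges of the universal complex through representing paths\<close>

lemma path_class_iff:
  assumes "p \<in> Paths \<sigma>0 \<tau>"
  shows "q \<in> path_class X \<sigma>0 p \<longleftrightarrow>
    q \<in> Paths \<sigma>0 \<tau> \<and> (\<exists>g\<in>carrier (grp X \<tau>). cls q = cls (p \<star> const_path \<tau> g))"
proof -
  have "q \<in> Paths \<sigma>0 \<tau>" if "cls q = cls (p \<star> const_path \<tau> g)" "g \<in> carrier (grp X \<tau>)" for g
    using that assms by (intro cls_closed[OF that(1)[symmetric]]) (simp add: Paths_verts[OF assms])
  then show ?thesis
    using assms by (auto simp: path_class_def xtrm_eq[OF assms] paths_between_from)
qed

lemma path_class_self:
  assumes "p \<in> Paths \<sigma>0 \<tau>"
  shows "p \<in> path_class X \<sigma>0 p"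
  using assms Paths_verts[OF assms]
  by (auto simp: path_class_iff[OF assms] intro!: bexI[of _ "\<one>\<^bsub>grp X \<tau>\<^esub>"])

text \<open>The class is an orbit of right multiplication by the local group at
  \<open>\<tau>\<close>: products of local elements give one inclusion, the inverse of the element
  relating \<open>p\<close> and \<open>q\<close> gives the other.\<close>

lemma path_class_eqI:
  assumes p: "p \<in> Paths \<sigma>0 \<tau>" and q: "q \<in> path_class X \<sigma>0 p"
  shows "path_class X \<sigma>0 q = path_class X \<sigma>0 p"
proof -
  note v = Paths_verts[OF p]
  have sub: "path_class X \<sigma>0 q \<subseteq> path_class X \<sigma>0 p"
    if p: "p \<in> Paths \<sigma>0 \<tau>" and q: "q \<in> path_class X \<sigma>0 p" for p q
  proof
    fix r assume r: "r \<in> path_class X \<sigma>0 q"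
    have q': "q \<in> Paths \<sigma>0 \<tau>" using q by (simp add: path_class_iff[OF p])
    obtain g where g: "g \<in> carrier (grp X \<tau>)" "cls q = cls (p \<star> const_path \<tau> g)"
      using q by (auto simp: path_class_iff[OF p])
    obtain k where k: "k \<in> carrier (grp X \<tau>)" "cls r = cls (q \<star> const_path \<tau> k)"
      and r': "r \<in> Paths \<sigma>0 \<tau>"
      using r by (auto simp: path_class_iff[OF q'])
    have "cls r = cls (p \<star> const_path \<tau> g \<star> const_path \<tau> k)"
      unfolding k using g k v q' by (intro cls_concat[of _ _ _ _ \<sigma>0 \<tau> \<tau>]) auto
    also have "p \<star> const_path \<tau> g \<star> const_path \<tau> k = p \<star> const_path \<tau> (g \<otimes>\<^bsub>grp X \<tau>\<^esub> k)"
      using concat_assoc[OF p, of "const_path \<tau> g" \<tau> "const_path \<tau> k" \<tau>] g k v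
      by (simp add: const_concat)
    finally show "r \<in> path_class X \<sigma>0 p"
      using r' g k v by (auto simp: path_class_iff[OF p])
  qed
  have q': "q \<in> Paths \<sigma>0 \<tau>" using q by (simp add: path_class_iff[OF p])
  obtain g where g: "g \<in> carrier (grp X \<tau>)" "cls q = cls (p \<star> const_path \<tau> g)"
    using q by (auto simp: path_class_iff[OF p])
  let ?k = "inv\<^bsub>grp X \<tau>\<^esub> g"
  have "cls (q \<star> const_path \<tau> ?k) = cls (p \<star> const_path \<tau> g \<star> const_path \<tau> ?k)"
    using g v q' by (intro cls_concat[of _ _ _ _ \<sigma>0 \<tau> \<tau>]) auto
  also have "p \<star> const_path \<tau> g \<star> const_path \<tau> ?k = p"
    using concat_assoc[OF p, of "const_path \<tau> g" \<tau> "const_path \<tau> ?k" \<tau>] g v p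
    by (simp add: const_concat)
  finally have "p \<in> path_class X \<sigma>0 q"
    using p g v by (auto simp: path_class_iff[OF q'] intro!: bexI[of _ ?k])
  then show ?thesis using sub[OF p q] sub[OF q'] by blast
qed

lemma path_class_eq_iff:
  assumes "p \<in> Paths \<sigma>0 \<tau>"  and "q \<in> Paths \<sigma>0 \<rho>"
  shows "path_class X \<sigma>0 q = path_class X \<sigma>0 p \<longleftrightarrow> q \<in> path_class X \<sigma>0 p"
  using path_class_eqI[OF assms(1)] path_class_self[OF assms(2)] by blast

lemma path_class_eq_rightI:
  assumes "p \<in> Paths \<sigma>0 \<tau>" and "g \<in> carrier (grp X \<tau>)" and "cls q = cls (p \<star> const_path \<tau> g)"
  shows "path_class X \<sigma>0 q = path_class X \<sigma>0 p"
proof -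
  have "p \<star> const_path \<tau> g \<in> Paths \<sigma>0 \<tau>" using assms Paths_verts[OF assms(1)] by simp
  then have "q \<in> Paths \<sigma>0 \<tau>" using cls_closed assms(3) by metis
  then have "q \<in> path_class X \<sigma>0 p" using assms by (auto simp: path_class_iff[OF assms(1)])
  then show ?thesis by (rule path_class_eqI[OF assms(1)])
qed

lemma path_class_cls:
  assumes "p \<in> Paths \<sigma>0 \<tau>" and "cls q = cls p"
  shows "path_class X \<sigma>0 q = path_class X \<sigma>0 p"
  using path_class_eq_rightI[OF assms(1), of "\<one>\<^bsub>grp X \<tau>\<^esub>" q] assms Paths_verts[OF assms(1)] by simp

text \<open>Makes the projection of the universal complex to \<open>X\<close> well defined on
  vertices; it separates the fibres later on.\<close>

lemma path_class_trm_unique: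
  assumes "p \<in> Paths \<sigma>0 \<tau>" and "q \<in> Paths \<sigma>0 \<rho>" and "path_class X \<sigma>0 q = path_class X \<sigma>0 p"
  shows "\<rho> = \<tau>"
proof -
  have "q \<in> Paths \<sigma>0 \<tau>"
    using assms(3) path_class_iff[OF assms(1)] path_class_eq_iff[OF assms(1,2)] by blast
  then show ?thesis using xtrm_eq[OF assms(2)] xtrm_eq[of q X \<sigma>0 \<tau>] by simp
qed

text \<open>Well-definedness of the action on vertices: the local element relating \<open>q\<close>
  and \<open>p\<close> stays on the far right, where the class absorbs it.\<close>

lemma path_class_concat_left:
  assumes p: "p \<in> Paths \<sigma>0 \<tau>" and q: "q \<in> path_class X \<sigma>0 p"
    and r: "r \<in> Paths \<sigma>0 \<sigma>0" "cls r' = cls r"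
  shows "path_class X \<sigma>0 (r' \<star> q) = path_class X \<sigma>0 (r \<star> p)"
proof -
  note v = Paths_verts[OF p]
  have q': "q \<in> Paths \<sigma>0 \<tau>" using q by (simp add: path_class_iff[OF p])
  have r': "r' \<in> Paths \<sigma>0 \<sigma>0" using cls_closed r by metis
  obtain g where g: "g \<in> carrier (grp X \<tau>)" "cls q = cls (p \<star> const_path \<tau> g)"
    using q by (auto simp: path_class_iff[OF p])
  have "cls (r' \<star> q) = cls (r \<star> (p \<star> const_path \<tau> g))"
    using g r r' q' by (intro cls_concat[of _ _ _ _ \<sigma>0 \<sigma>0 \<tau>]) auto
  also have "r \<star> (p \<star> const_path \<tau> g) = r \<star> p \<star> const_path \<tau> g"
    using concat_assoc[OF r(1) p, of "const_path \<tau> g" \<tau>] g v by simp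
  finally show ?thesis
    by (rule path_class_eq_rightI[OF concat_closed[OF r(1) p] g(1)])
qed

lemma universal_actv_path_class:
  assumes "p \<in> Paths \<sigma>0 \<tau>" and "r \<in> Paths \<sigma>0 \<sigma>0"
  shows "universal_actv X \<sigma>0 (cls r) (path_class X \<sigma>0 p) = path_class X \<sigma>0 (r \<star> p)"
  unfolding universal_actv_def
  by (intro UN_constant_eq[OF self_mem_cls] UN_constant_eq[OF path_class_self[OF assms(1)]] ballI
      path_class_concat_left[OF assms(1) _ assms(2)] mem_clsD)

text \<open>Well-definedness of the terminal vertex of an edge: a local element \<open>g\<close>
  before the edge moves across it as \<open>psi X a g\<close>, which the class absorbs.\<close>

lemma path_class_concat_edge:
  assumes a: "a \<in> edges X" and p: "p \<in> Paths \<sigma>0 (ini X a)" and q: "q \<in> path_class X \<sigma>0 p"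
  shows "path_class X \<sigma>0 (q \<star> edge_xpath X (Fwd a)) = path_class X \<sigma>0 (p \<star> edge_xpath X (Fwd a))"
proof -
  let ?e = "edge_xpath X (Fwd a)"
  note v = Paths_verts[OF p]
  have e: "?e \<in> Paths (ini X a) (trm X a)" using a by simp
  have q': "q \<in> Paths \<sigma>0 (ini X a)" using q by (simp add: path_class_iff[OF p])
  obtain g where g: "g \<in> carrier (grp X (ini X a))" "cls q = cls (p \<star> const_path (ini X a) g)"
    using q by (auto simp: path_class_iff[OF p])
  have c: "const_path (ini X a) g \<in> Paths (ini X a) (ini X a)"
    "const_path (trm X a) (psi X a g) \<in> Paths (trm X a) (trm X a)"
    using g a by simp_all
  have "cls (q \<star> ?e) = cls (p \<star> const_path (ini X a) g \<star> ?e)"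
    using g q' e by (intro cls_concat[of _ _ _ _ \<sigma>0 "ini X a" "trm X a"]) auto
  also have "p \<star> const_path (ini X a) g \<star> ?e = p \<star> (const_path (ini X a) g \<star> ?e)"
    using concat_assoc[OF p c(1) e] .
  also have "cls \<dots> = cls (p \<star> (?e \<star> const_path (trm X a) (psi X a g)))"
    using cls_concat[OF refl cls_const_edge[OF a g(1)] p concat_closed[OF c(1) e]] .
  also have "p \<star> (?e \<star> const_path (trm X a) (psi X a g)) = p \<star> ?e \<star> const_path (trm X a) (psi X a g)"
    using concat_assoc[OF p e c(2)] by simp
  finally show ?thesis
    by (rule path_class_eq_rightI[OF concat_closed[OF p e] psi_closed[OF a g(1)]])
qed

lemma extend_class_path_class:
  assumes "a \<in> edges X" and "p \<in> Paths \<sigma>0 (ini X a)"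
  shows "extend_class X \<sigma>0 (path_class X \<sigma>0 p) a = path_class X \<sigma>0 (p \<star> edge_xpath X (Fwd a))"
  unfolding extend_class_def single_edge_path_eq
  by (intro UN_constant_eq[OF path_class_self[OF assms(2)]] ballI path_class_concat_edge[OF assms])

end

section \<open>Complexes of groups inside a group\<close>

text \<open>\<open>Y\<close> is not assumed to be a scwol; its axioms are carried over from
  \<open>X\<close>. Bijectivity on stars follows from the bijection on all edges and injectivity on
  vertices. In this way the quotient is handled without checking its scwol axioms on orbits.\<close>

lemma scwol_isomorphism_transport:
  assumes "scwol X" and fv: "bij_betw fv (verts X) (verts Y)" and fe: "bij_betw fe (edges X) (edges Y)"
    and ini: "\<And>a. a \<in> edges X \<Longrightarrow> ini Y (fe a) = fv (ini X a)"
    and trm: "\<And>a. a \<in> edges X \<Longrightarrow> trm Y (fe a) = fv (trm X a)"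
    and cmp: "\<And>a b. \<lbrakk>a \<in> edges X; b \<in> edges X; ini X a = trm X b\<rbrakk>
      \<Longrightarrow> cmp Y (fe a) (fe b) = fe (cmp X a b)"
  shows "scwol_isomorphism X Y fv fe"
proof -
  interpret scwol X by fact
  have fe_image: "edges Y = fe ` edges X" and fe_inj: "inj_on fe (edges X)"
    using fe by (auto simp: bij_betw_def)
  have fv_closed: "fv \<sigma> \<in> verts Y" if "\<sigma> \<in> verts X" for \<sigma>
    using fv that by (auto simp: bij_betw_def)
  have fv_eq: "fv \<sigma> = fv \<tau> \<longleftrightarrow> \<sigma> = \<tau>" if "\<sigma> \<in> verts X" "\<tau> \<in> verts X" for \<sigma> \<tau>
    using fv that by (auto simp: bij_betw_def dest: inj_onD)
  note simps = ini trm cmp fv_eq fv_closed ini_closed trm_closed cmp_closed ini_cmp trm_cmp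
  interpret Y: scwol Y
    by unfold_locales (auto simp: fe_image simps cmp_assoc no_loops)
  have "scwol_morphism X Y fv fe"
  proof unfold_locales
    fix \<sigma> assume \<sigma>: "\<sigma> \<in> verts X"
    have "inj_on fe {a \<in> edges X. ini X a = \<sigma>}" using fe_inj by (rule inj_on_subset) auto
    moreover have "fe ` {a \<in> edges X. ini X a = \<sigma>} = {a' \<in> edges Y. ini Y a' = fv \<sigma>}"
      using \<sigma> by (auto simp: fe_image simps)
    ultimately show "bij_betw fe {a \<in> edges X. ini X a = \<sigma>} {a' \<in> edges Y. ini Y a' = fv \<sigma>}"
      by (simp add: bij_betw_def)
  qed (auto simp: fe_image simps)
  then show ?thesis using fv fe by (simp add: scwol_isomorphism_def)
qed

text \<open>Rewrite rules that associate words to the right, distribute inverses and cancel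
  neighbouring inverse letters; the identities in the ambient group below are settled by this normal
  form.\<close>

lemma (in group) word_simps:
  "\<lbrakk>x \<in> carrier G; y \<in> carrier G; z \<in> carrier G\<rbrakk> \<Longrightarrow> x \<otimes> y \<otimes> z = x \<otimes> (y \<otimes> z)"
  "\<lbrakk>x \<in> carrier G; y \<in> carrier G\<rbrakk> \<Longrightarrow> inv (x \<otimes> y) = inv y \<otimes> inv x"
  "\<lbrakk>x \<in> carrier G; y \<in> carrier G\<rbrakk> \<Longrightarrow> x \<otimes> (inv x \<otimes> y) = y"
  "\<lbrakk>x \<in> carrier G; y \<in> carrier G\<rbrakk> \<Longrightarrow> inv x \<otimes> (x \<otimes> y) = y"
  by (simp_all add: m_assoc inv_mult_group flip: m_assoc)

lemma (in group) conj_by_hom: "x \<in> carrier G \<Longrightarrow> conj_by G x \<in> hom G G"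
  by (auto simp: hom_def conj_by_def word_simps)

lemma (in group) conj_by_inj: "x \<in> carrier G \<Longrightarrow> inj_on (conj_by G x) (carrier G)"
  by (auto simp: conj_by_def intro!: inj_onI)

lemma (in group) conj_by_subgroup:
  "\<lbrakk>subgroup K G; x \<in> K\<rbrakk> \<Longrightarrow> conj_by (G\<lparr>carrier := K\<rparr>) x y = conj_by G x y"
  by (simp add: conj_by_def m_inv_consistent)

text \<open>
  In the application \<open>H\<close> is the fundamental group and \<open>S (fv \<sigma>)\<close> the stabilizer of the
  representative over \<open>\<sigma>\<close>. The assumptions on \<open>\<phi>\<close> and \<open>A\<close> are the relations between group
  elements and edges in the fundamental groupoid, transported to \<open>H\<close>.
\<close>

locale embedded_complex = complex_of_groups X + H: group H
  for X :: "('v, 'e, 'g) complex_of_groups" and H :: "'h monoid" (structure) +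
  fixes W :: "('w, 'f) scwol" and S :: "'w \<Rightarrow> 'h set" and h :: "'f \<Rightarrow> 'h"
    and fv :: "'v \<Rightarrow> 'w" and fe :: "'e \<Rightarrow> 'f" and \<phi> :: "'v \<Rightarrow> 'g \<Rightarrow> 'h" and A :: "'e \<Rightarrow> 'h"
  assumes fv_bij: "bij_betw fv (verts X) (verts W)" and fe_bij: "bij_betw fe (edges X) (edges W)"
    and ini_fe: "a \<in> edges X \<Longrightarrow> ini W (fe a) = fv (ini X a)"
    and trm_fe: "a \<in> edges X \<Longrightarrow> trm W (fe a) = fv (trm X a)"
    and cmp_fe: "\<lbrakk>a \<in> edges X; b \<in> edges X; ini X a = trm X b\<rbrakk>
      \<Longrightarrow> cmp W (fe a) (fe b) = fe (cmp X a b)"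
    and \<phi>_hom: "\<sigma> \<in> verts X \<Longrightarrow> \<phi> \<sigma> \<in> hom (grp X \<sigma>) H"
    and \<phi>_inj: "\<sigma> \<in> verts X \<Longrightarrow> inj_on (\<phi> \<sigma>) (carrier (grp X \<sigma>))"
    and \<phi>_image: "\<sigma> \<in> verts X \<Longrightarrow> \<phi> \<sigma> ` carrier (grp X \<sigma>) = S (fv \<sigma>)"
    and h_closed: "a \<in> edges X \<Longrightarrow> h (fe a) \<in> carrier H"
    and A_closed: "a \<in> edges X \<Longrightarrow> A a \<in> carrier H"
    and \<phi>_A: "\<lbrakk>a \<in> edges X; g \<in> carrier (grp X (ini X a))\<rbrakk>
      \<Longrightarrow> \<phi> (ini X a) g \<otimes> A a = A a \<otimes> \<phi> (trm X a) (psi X a g)"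
    and A_cmp: "\<lbrakk>a \<in> edges X; b \<in> edges X; ini X a = trm X b\<rbrakk>
      \<Longrightarrow> A b \<otimes> A a \<otimes> \<phi> (trm X a) (twist X a b) = A (cmp X a b)"
    and h_A: "a \<in> edges X \<Longrightarrow> h (fe a) \<otimes> A a \<in> S (fv (trm X a))"
begin

text \<open>Has the shape of \<open>induced_complex\<close>, but with abstract quotient
  \<open>W\<close> and subgroups \<open>S\<close> in place of stabilizers, so that the two agree by
  unfolding in the application.\<close>

definition realized :: "('w, 'f, 'h) complex_of_groups" where
  "realized = \<lparr>verts = verts W, edges = edges W, ini = ini W, trm = trm W, cmp = cmp W,
       grp = (\<lambda>\<sigma>. H\<lparr>carrier := S \<sigma>\<rparr>),
       psi = (\<lambda>a. conj_by H (h a)),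
       twist = (\<lambda>a b. h a \<otimes> h b \<otimes> inv (h (cmp W a b)))\<rparr>"

lemma realized_simps [simp]:
  "verts realized = verts W" "edges realized = edges W" "ini realized = ini W" "trm realized = trm W" "cmp realized = cmp W"
  "grp realized \<sigma> = H\<lparr>carrier := S \<sigma>\<rparr>" "psi realized a = conj_by H (h a)"
  "twist realized a b = h a \<otimes> h b \<otimes> inv (h (cmp W a b))"
  by (simp_all add: realized_def)

section \<open>The realized structure maps stay inside the subgroups \<open>S\<close>\<close>

lemma scwol_iso: "scwol_isomorphism X realized fv fe"
  by (rule scwol_isomorphism_transport)
    (use scwol_axioms fv_bij fe_bij ini_fe trm_fe cmp_fe in simp_all)

lemma subgroup_S: "\<sigma> \<in> verts X \<Longrightarrow> subgroup (S (fv \<sigma>)) H"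
  using group_hom.img_is_subgroup[of "grp X \<sigma>" H "\<phi> \<sigma>"] \<phi>_hom \<phi>_image
  by (simp add: group_hom_def group_hom_axioms_def)

lemma S_carrier: "\<sigma> \<in> verts X \<Longrightarrow> x \<in> S (fv \<sigma>) \<Longrightarrow> x \<in> carrier H"
  using subgroup_S subgroup.mem_carrier by fast

lemma \<phi>_closed: "\<sigma> \<in> verts X \<Longrightarrow> g \<in> carrier (grp X \<sigma>) \<Longrightarrow> \<phi> \<sigma> g \<in> S (fv \<sigma>)"
  using \<phi>_image by blast

lemma S_mult: "\<sigma> \<in> verts X \<Longrightarrow> x \<in> S (fv \<sigma>) \<Longrightarrow> y \<in> S (fv \<sigma>) \<Longrightarrow> x \<otimes> y \<in> S (fv \<sigma>)"
  using subgroup_S subgroup.m_closed by fast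

lemma S_inv: "\<sigma> \<in> verts X \<Longrightarrow> x \<in> S (fv \<sigma>) \<Longrightarrow> inv x \<in> S (fv \<sigma>)"
  using subgroup_S subgroup.m_inv_closed by fast

lemma \<phi>_carrier: "\<sigma> \<in> verts X \<Longrightarrow> g \<in> carrier (grp X \<sigma>) \<Longrightarrow> \<phi> \<sigma> g \<in> carrier H"
  using S_carrier \<phi>_closed by blast

text \<open>The discrepancy between the chosen \<open>h\<close> and the image \<open>A\<close> of
  the edge in \<open>H\<close>. Its inverse is the element that the isomorphism attaches to
  \<open>a\<close>.\<close>

definition "c a = h (fe a) \<otimes> A a"

lemma c_S: "a \<in> edges X \<Longrightarrow> c a \<in> S (fv (trm X a))"
  using h_A by (simp add: c_def)

text \<open>Write \<open>h (fe a)\<close> as \<open>c a \<otimes> inv (A a)\<close>; by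
  \<open>\<phi>_A\<close>, conjugating with \<open>inv (A a)\<close> realizes
  \<open>psi X a\<close>.\<close>

lemma conj_h:
  assumes a: "a \<in> edges X" and g: "g \<in> carrier (grp X (ini X a))"
  shows "conj_by H (h (fe a)) (\<phi> (ini X a) g) = c a \<otimes> \<phi> (trm X a) (psi X a g) \<otimes> inv (c a)"
proof -
  have x: "\<phi> (ini X a) g \<in> carrier H" and y: "\<phi> (trm X a) (psi X a g) \<in> carrier H"
    using a g by (simp_all add: \<phi>_carrier)
  have "c a \<otimes> \<phi> (trm X a) (psi X a g) \<otimes> inv (c a)
      = h (fe a) \<otimes> (A a \<otimes> \<phi> (trm X a) (psi X a g)) \<otimes> inv (c a)"
    using y h_closed[OF a] A_closed[OF a] by (simp add: c_def H.word_simps)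
  also have "\<dots> = conj_by H (h (fe a)) (\<phi> (ini X a) g)"
    unfolding \<phi>_A[OF a g, symmetric] conj_by_def
    using x h_closed[OF a] A_closed[OF a] by (simp add: c_def H.word_simps)
  finally show ?thesis by simp
qed

text \<open>As \<open>\<phi>\<close> maps onto \<open>S\<close>, the element has the form treated in
  \<open>conj_h\<close>, whose right side is a product of elements of the target subgroup.\<close>

lemma conj_h_closed:
  assumes a: "a \<in> edges X" and x: "x \<in> S (fv (ini X a))"
  shows "conj_by H (h (fe a)) x \<in> S (fv (trm X a))"
proof -
  obtain g where g: "g \<in> carrier (grp X (ini X a))" "x = \<phi> (ini X a) g"
    using x \<phi>_image[of "ini X a"] a by auto
  show ?thesis
    unfolding g(2) conj_h[OF a g(1)]
    using a g(1) c_S[OF a] by (intro S_mult S_inv \<phi>_closed) auto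
qed

text \<open>Each factor on the right lies in the subgroup over \<open>trm X a\<close>, which is not
  visible for the three factors on the left. The equation follows by expanding \<open>c\<close> and
  using \<open>A_cmp\<close> for the composite edge.\<close>

lemma twist_eq:
  assumes "a \<in> edges X" "b \<in> edges X" "ini X a = trm X b"
  shows "h (fe a) \<otimes> h (fe b) \<otimes> inv (h (fe (cmp X a b))) =
    conj_by H (h (fe a)) (c b) \<otimes> c a \<otimes> \<phi> (trm X a) (twist X a b) \<otimes> inv (c (cmp X a b))"
proof -
  have "\<phi> (trm X a) (twist X a b) \<in> carrier H"
    using assms by (simp_all add: \<phi>_carrier)
  then show ?thesis
    using assms by (simp add: c_def conj_by_def A_cmp[OF assms, symmetric] H.word_simps h_closed A_closed)
qed

lemma twist_closed_S:
  assumes "a \<in> edges X" "b \<in> edges X" "ini X a = trm X b"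
  shows "h (fe a) \<otimes> h (fe b) \<otimes> inv (h (fe (cmp X a b))) \<in> S (fv (trm X a))"
  unfolding twist_eq[OF assms] using assms c_S[of a] c_S[of b] c_S[of "cmp X a b"]
  by (intro S_mult S_inv \<phi>_closed conj_h_closed) auto

lemma complex_realized: "complex_of_groups realized"
proof -
  interpret R: scwol realized using scwol_iso by (simp add: scwol_isomorphism_def scwol_morphism_def)
  have fe_image: "edges W = fe ` edges X" and fv_image: "verts W = fv ` verts X"
    using fe_bij fv_bij by (auto simp: bij_betw_def)
  have fv_eq: "fv \<sigma> = fv \<tau> \<longleftrightarrow> \<sigma> = \<tau>" if "\<sigma> \<in> verts X" "\<tau> \<in> verts X" for \<sigma> \<tau>
    using fv_bij that by (auto simp: bij_betw_def dest: inj_onD)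
  show ?thesis
  \<comment> \<open>Vertices and edges of \<open>W\<close> are replaced by images of those of
    \<open>X\<close>, where the assumed relations apply.\<close>
  proof (intro complex_of_groups.intro complex_of_groups_axioms.intro;
      (simp only: realized_simps fe_image fv_image)?; (elim imageE; hypsubst)?)
    show "scwol realized" ..
    show "group (H\<lparr>carrier := S (fv \<sigma>)\<rparr>)" if "\<sigma> \<in> verts X" for \<sigma>
      using subgroup_S[OF that] H.subgroup_imp_group by blast
    show "conj_by H (h (fe a)) \<in> hom (H\<lparr>carrier := S (ini W (fe a))\<rparr>) (H\<lparr>carrier := S (trm W (fe a))\<rparr>)"
      if a: "a \<in> edges X" for a
      using hom_mult[OF H.conj_by_hom[OF h_closed[OF a]]] conj_h_closed[OF a] S_carrier[of "ini X a"] a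
      by (intro homI) (simp_all add: ini_fe trm_fe)
    show "inj_on (conj_by H (h (fe a))) (carrier (H\<lparr>carrier := S (ini W (fe a))\<rparr>))"
      if a: "a \<in> edges X" for a
      using H.conj_by_inj[OF h_closed[OF a]] S_carrier[of "ini X a"] a
      by (auto simp: ini_fe intro: inj_on_subset)
    show "h (fe a) \<otimes> h (fe b) \<otimes> inv (h (cmp W (fe a) (fe b))) \<in> carrier (H\<lparr>carrier := S (trm W (fe a))\<rparr>)"
      if "ini W (fe a) = trm W (fe b)" "a \<in> edges X" "b \<in> edges X" for a b
      using that twist_closed_S by (simp add: cmp_fe trm_fe ini_fe fv_eq)
    show "conj_by (H\<lparr>carrier := S (trm W (fe a))\<rparr>) (h (fe a) \<otimes> h (fe b) \<otimes> inv (h (cmp W (fe a) (fe b))))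
        (conj_by H (h (cmp W (fe a) (fe b))) x) = conj_by H (h (fe a)) (conj_by H (h (fe b)) x)"
      if "ini W (fe a) = trm W (fe b)" "x \<in> carrier (H\<lparr>carrier := S (ini W (fe b))\<rparr>)"
        "a \<in> edges X" "b \<in> edges X" for a b x
    proof -
      have eq: "ini X a = trm X b" and x: "x \<in> carrier H"
        using that S_carrier[of "ini X b"] by (auto simp: trm_fe ini_fe fv_eq)
      show ?thesis
        using that(3,4) eq x H.conj_by_subgroup[OF subgroup_S twist_closed_S]
        by (simp add: cmp_fe trm_fe) (simp add: conj_by_def H.word_simps h_closed)
    qed
    \<comment> \<open>Both sides reduce to \<open>h\<close> at \<open>a\<close>, \<open>b\<close>
      and \<open>d\<close> followed by the inverse of \<open>h\<close> at the triple composite,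
      which is unambiguous by associativity in \<open>X\<close>.\<close>
    show "conj_by H (h (fe a)) (h (fe b) \<otimes> h (fe d) \<otimes> inv (h (cmp W (fe b) (fe d))))
          \<otimes>\<^bsub>H\<lparr>carrier := S (trm W (fe a))\<rparr>\<^esub>
        (h (fe a) \<otimes> h (cmp W (fe b) (fe d)) \<otimes> inv (h (cmp W (fe a) (cmp W (fe b) (fe d))))) =
        h (fe a) \<otimes> h (fe b) \<otimes> inv (h (cmp W (fe a) (fe b))) \<otimes>\<^bsub>H\<lparr>carrier := S (trm W (fe a))\<rparr>\<^esub>
        (h (cmp W (fe a) (fe b)) \<otimes> h (fe d) \<otimes> inv (h (cmp W (cmp W (fe a) (fe b)) (fe d))))"
      if "ini W (fe a) = trm W (fe b)" "ini W (fe b) = trm W (fe d)"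
        "a \<in> edges X" "b \<in> edges X" "d \<in> edges X" for a b d
    proof -
      have "ini X a = trm X b" "ini X b = trm X d"
        using that by (auto simp: trm_fe ini_fe fv_eq)
      then show ?thesis
        using that(3-5) by (simp add: cmp_fe cmp_assoc conj_by_def H.word_simps h_closed)
    qed
  qed
qed

text \<open>By \<open>conj_h\<close>, the structure map over \<open>a\<close> differs from
  \<open>psi X a\<close> by conjugation with \<open>c a\<close>. Conjugating with
  \<open>inv (c a)\<close> undoes this, which dictates the choice of \<open>elt\<close>.\<close>

theorem isomorphism:
  "complex_isomorphism X realized
    \<lparr>vmap = fv, emap = fe, locmap = \<phi>, elt = (\<lambda>a. inv (c a))\<rparr>"
proof -
  have morph: "scwol_morphism X realized fv fe" using scwol_iso by (simp add: scwol_isomorphism_def)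
  have "complex_morphism X realized \<lparr>vmap = fv, emap = fe, locmap = \<phi>, elt = (\<lambda>a. inv (c a))\<rparr>"
  proof (intro complex_morphism.intro complex_morphism_axioms.intro; (simp only: complex_map.simps realized_simps)?)
    show "complex_of_groups X" ..
    show "complex_of_groups realized" by (rule complex_realized)
    show "scwol_morphism X realized fv fe" by (rule morph)
    show "\<phi> \<sigma> \<in> hom (grp X \<sigma>) (H\<lparr>carrier := S (fv \<sigma>)\<rparr>)" if "\<sigma> \<in> verts X" for \<sigma>
      using \<phi>_hom[OF that] \<phi>_closed[OF that] by (auto simp: hom_def)
    show "inv (c a) \<in> carrier (H\<lparr>carrier := S (fv (trm X a))\<rparr>)" if "a \<in> edges X" for a
      using c_S[OF that] S_inv that by simp
    show "conj_by (H\<lparr>carrier := S (fv (trm X a))\<rparr>) (inv (c a)) (conj_by H (h (fe a)) (\<phi> (ini X a) g)) =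
        \<phi> (trm X a) (psi X a g)" if "a \<in> edges X" "g \<in> carrier (grp X (ini X a))" for a g
    proof -
      have "\<phi> (trm X a) (psi X a g) \<in> carrier H"
        using that by (simp_all add: \<phi>_carrier)
      then show ?thesis
        using that H.conj_by_subgroup[OF subgroup_S S_inv[OF _ c_S[OF that(1)]]]
        by (simp add: conj_h) (simp add: c_def conj_by_def H.word_simps h_closed A_closed)
    qed
    \<comment> \<open>After \<open>A_cmp\<close> both sides are the word \<open>inv (A a) \<otimes>
      inv (A b) \<otimes> inv (h (fe (cmp X a b)))\<close>.\<close>
    show "\<phi> (trm X a) (twist X a b) \<otimes>\<^bsub>H\<lparr>carrier := S (fv (trm X a))\<rparr>\<^esub> inv (c (cmp X a b)) =
        inv (c a) \<otimes>\<^bsub>H\<lparr>carrier := S (fv (trm X a))\<rparr>\<^esub> conj_by H (h (fe a)) (inv (c b))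
          \<otimes>\<^bsub>H\<lparr>carrier := S (fv (trm X a))\<rparr>\<^esub>
          (h (fe a) \<otimes> h (fe b) \<otimes> inv (h (cmp W (fe a) (fe b))))"
      if "a \<in> edges X" "b \<in> edges X" "ini X a = trm X b" for a b
    proof -
      have "\<phi> (trm X a) (twist X a b) \<in> carrier H"
        using that by (simp_all add: \<phi>_carrier)
      then show ?thesis
        using that by (simp add: c_def cmp_fe A_cmp[OF that, symmetric] conj_by_def H.word_simps h_closed A_closed)
    qed
  qed
  moreover have "\<phi> \<sigma> \<in> iso (grp X \<sigma>) (H\<lparr>carrier := S (fv \<sigma>)\<rparr>)" if "\<sigma> \<in> verts X" for \<sigma>
    using \<phi>_hom[OF that] \<phi>_closed[OF that] \<phi>_inj[OF that] \<phi>_image[OF that]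
    by (auto simp: hom_def iso_def bij_betw_def)
  ultimately show ?thesis
    using scwol_iso by (simp add: complex_isomorphism_def)
qed

end

section \<open>The quotient of the universal complex\<close>

context complex_of_groups
begin

text \<open>The fibre over \<open>\<tau>\<close> of the projection from the universal complex to
  \<open>X\<close>. Orbits will be identified with such fibres.\<close>

definition vert_fibre :: "'v \<Rightarrow> 'v \<Rightarrow> ('v, 'e, 'g) xpath set set" where
  "vert_fibre \<sigma>0 \<tau> = path_class X \<sigma>0 ` Paths \<sigma>0 \<tau>"

definition edge_over ::
  "'v \<Rightarrow> 'e \<Rightarrow> ('v, 'e, 'g) xpath \<Rightarrow> ('v, 'e, 'g) xpath set \<times> 'e \<times> ('v, 'e, 'g) xpath set" where
  "edge_over \<sigma>0 a p = (path_class X \<sigma>0 p, a, path_class X \<sigma>0 (p \<star> edge_xpath X (Fwd a)))"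

definition edge_fibre ::
  "'v \<Rightarrow> 'e \<Rightarrow> (('v, 'e, 'g) xpath set \<times> 'e \<times> ('v, 'e, 'g) xpath set) set" where
  "edge_fibre \<sigma>0 a = edge_over \<sigma>0 a ` Paths \<sigma>0 (ini X a)"

section \<open>Cancellation up to homotopy, and orbits as fibres\<close>

lemma inverse_path_sym: "inverse_path \<sigma> \<tau> p q \<Longrightarrow> inverse_path \<tau> \<sigma> q p"
  by (auto simp: inverse_path_def)

lemma inverse_path_closed:
  "inverse_path \<sigma> \<tau> p q \<Longrightarrow> p \<in> Paths \<sigma> \<tau>" "inverse_path \<sigma> \<tau> p q \<Longrightarrow> q \<in> Paths \<tau> \<sigma>"
  by (auto simp: inverse_path_def)

lemma cls_cancel_right:
  assumes "inverse_path \<sigma> \<tau> p q" and "r \<in> Paths \<rho> \<sigma>"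
  shows "cls (r \<star> p \<star> q) = cls r"
proof -
  note pq = inverse_path_closed[OF assms(1)]
  have "cls (r \<star> p \<star> q) = cls (r \<star> (p \<star> q))"
    using concat_assoc[OF assms(2) pq] by simp
  also have "\<dots> = cls (r \<star> const_path \<sigma> \<one>\<^bsub>grp X \<sigma>\<^esub>)"
    using assms cls_concat[OF refl _ assms(2) concat_closed[OF pq]] by (simp add: inverse_path_def)
  finally show ?thesis using assms(2) by simp
qed

lemma cls_cancel_middle:
  assumes "inverse_path \<sigma> \<tau> p q" and "r \<in> Paths \<rho> \<sigma>" and "s \<in> Paths \<sigma> \<upsilon>"
  shows "cls (r \<star> p \<star> (q \<star> s)) = cls (r \<star> s)"
proof -
  note pq = inverse_path_closed[OF assms(1)]
  have "r \<star> p \<star> (q \<star> s) = r \<star> p \<star> q \<star> s"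
    using concat_assoc[OF concat_closed[OF assms(2) pq(1)] pq(2) assms(3)] by simp
  then show ?thesis
    using cls_concat[OF cls_cancel_right[OF assms(1,2)] refl _ assms(3)] pq assms(2)
    by (metis concat_closed)
qed

text \<open>Loops at \<open>\<sigma>0\<close> preserve terminal vertices. Conversely, the loop
  \<open>q \<star> p'\<close> carries the class of \<open>p\<close> to that of \<open>q\<close>, so
  the action is transitive on the fibre.\<close>

lemma orbit_vert:
  assumes p: "p \<in> Paths \<sigma>0 \<tau>"
  shows "orbit (fundamental_group X \<sigma>0) (universal_actv X \<sigma>0) (path_class X \<sigma>0 p) = vert_fibre \<sigma>0 \<tau>"
proof -
  obtain p' where p': "inverse_path \<sigma>0 \<tau> p p'" using inverse_path_exists[OF p] by blast
  have "orbit (fundamental_group X \<sigma>0) (universal_actv X \<sigma>0) (path_class X \<sigma>0 p)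
      = (\<lambda>r. path_class X \<sigma>0 (r \<star> p)) ` Paths \<sigma>0 \<sigma>0"
    using universal_actv_path_class[OF p] by (force simp: orbit_def carrier_fundamental_group)
  also have "\<dots> = vert_fibre \<sigma>0 \<tau>"
    unfolding vert_fibre_def
  proof (intro equalityI subsetI; elim imageE; hypsubst)
    fix r assume "r \<in> Paths \<sigma>0 \<sigma>0"
    then show "path_class X \<sigma>0 (r \<star> p) \<in> path_class X \<sigma>0 ` Paths \<sigma>0 \<tau>" using p by auto
  next
    fix q assume q: "q \<in> Paths \<sigma>0 \<tau>"
    then have "path_class X \<sigma>0 q = path_class X \<sigma>0 (q \<star> p' \<star> p)"
      by (intro path_class_cls[symmetric] cls_cancel_right[OF inverse_path_sym[OF p']])
    then show "path_class X \<sigma>0 q \<in> (\<lambda>r. path_class X \<sigma>0 (r \<star> p)) ` Paths \<sigma>0 \<sigma>0"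
      using concat_closed[OF q inverse_path_closed(2)[OF p']] by blast
  qed
  finally show ?thesis .
qed

lemma universal_acte_edge_over:
  assumes "a \<in> edges X" and "p \<in> Paths \<sigma>0 (ini X a)" and "r \<in> Paths \<sigma>0 \<sigma>0"
  shows "universal_acte X \<sigma>0 (cls r) (edge_over \<sigma>0 a p) = edge_over \<sigma>0 a (r \<star> p)"
  using assms concat_closed[OF assms(3,2)]
  by (simp add: universal_acte_def edge_over_def universal_actv_path_class extend_class_path_class)

text \<open>The third component of an edge is computed by \<open>extend_class\<close> from the
  first, so the initial class and the label determine the edge.\<close>

lemma edge_over_eqI:
  assumes "a \<in> edges X" and "p \<in> Paths \<sigma>0 (ini X a)" and "q \<in> Paths \<sigma>0 (ini X a)"
    and "path_class X \<sigma>0 q = path_class X \<sigma>0 p"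
  shows "edge_over \<sigma>0 a q = edge_over \<sigma>0 a p"
  using extend_class_path_class[OF assms(1,2)] extend_class_path_class[OF assms(1,3)] assms(4)
  by (simp add: edge_over_def)

lemma orbit_edge:
  assumes a: "a \<in> edges X" and p: "p \<in> Paths \<sigma>0 (ini X a)"
  shows "orbit (fundamental_group X \<sigma>0) (universal_acte X \<sigma>0) (edge_over \<sigma>0 a p) = edge_fibre \<sigma>0 a"
proof -
  obtain p' where p': "inverse_path \<sigma>0 (ini X a) p p'" using inverse_path_exists[OF p] by blast
  have "orbit (fundamental_group X \<sigma>0) (universal_acte X \<sigma>0) (edge_over \<sigma>0 a p)
      = (\<lambda>r. edge_over \<sigma>0 a (r \<star> p)) ` Paths \<sigma>0 \<sigma>0"
    using universal_acte_edge_over[OF a p] by (force simp: orbit_def carrier_fundamental_group)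
  also have "\<dots> = edge_fibre \<sigma>0 a"
    unfolding edge_fibre_def
  proof (intro equalityI subsetI; elim imageE; hypsubst)
    fix r assume "r \<in> Paths \<sigma>0 \<sigma>0"
    then show "edge_over \<sigma>0 a (r \<star> p) \<in> edge_over \<sigma>0 a ` Paths \<sigma>0 (ini X a)" using p by auto
  next
    fix q assume q: "q \<in> Paths \<sigma>0 (ini X a)"
    have r: "q \<star> p' \<in> Paths \<sigma>0 \<sigma>0" using q inverse_path_closed(2)[OF p'] by (rule concat_closed)
    have "edge_over \<sigma>0 a q = edge_over \<sigma>0 a (q \<star> p' \<star> p)"
      using a q concat_closed[OF r p]
      by (intro edge_over_eqI path_class_cls[symmetric] cls_cancel_right[OF inverse_path_sym[OF p']])
    then show "edge_over \<sigma>0 a q \<in> (\<lambda>r. edge_over \<sigma>0 a (r \<star> p)) ` Paths \<sigma>0 \<sigma>0"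
      using r by blast
  qed
  finally show ?thesis .
qed

section \<open>Structure maps of the universal complex on fibres\<close>

lemma verts_universal: "verts (universal_scwol X \<sigma>0) = {path_class X \<sigma>0 p | p \<tau>. p \<in> Paths \<sigma>0 \<tau>}"
  by (auto simp: universal_scwol_def paths_from_iff intro!: imageI)

lemma edges_universal:
  "edges (universal_scwol X \<sigma>0) = {edge_over \<sigma>0 a p | a p. a \<in> edges X \<and> p \<in> Paths \<sigma>0 (ini X a)}"
proof -
  have "p \<in> paths_from X \<sigma>0 \<and> a \<in> edges X \<and> ini X a = xtrm X p \<longleftrightarrow>
      a \<in> edges X \<and> p \<in> Paths \<sigma>0 (ini X a)" for p a
    by (auto simp: paths_from_def paths_between_def)
  then show ?thesis by (auto simp: universal_scwol_def edge_over_def single_edge_path_eq)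
qed

lemma ini_edge_over [simp]: "ini (universal_scwol X \<sigma>0) (edge_over \<sigma>0 a p) = path_class X \<sigma>0 p"
  by (simp add: universal_scwol_def edge_over_def)

lemma trm_edge_over [simp]:
  "trm (universal_scwol X \<sigma>0) (edge_over \<sigma>0 a p) = path_class X \<sigma>0 (p \<star> edge_xpath X (Fwd a))"
  by (simp add: universal_scwol_def edge_over_def)

lemma cmp_edge_over:
  assumes "a \<in> edges X" "b \<in> edges X" "ini X a = trm X b" "p \<in> Paths \<sigma>0 (ini X b)"
  shows "cmp (universal_scwol X \<sigma>0) (edge_over \<sigma>0 a q) (edge_over \<sigma>0 b p) = edge_over \<sigma>0 (cmp X a b) p"
  using assms extend_class_path_class[of "cmp X a b" p \<sigma>0]
  by (simp add: universal_scwol_def edge_over_def)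

lemma ini_edge_fibre: "ini (universal_scwol X \<sigma>0) ` edge_fibre \<sigma>0 a = vert_fibre \<sigma>0 (ini X a)"
  by (simp add: edge_fibre_def vert_fibre_def image_image)

text \<open>For surjectivity, a path ending at \<open>trm X a\<close> is first continued backwards
  along the edge; going forward again returns to its class.\<close>

lemma trm_edge_fibre:
  assumes a: "a \<in> edges X"
  shows "trm (universal_scwol X \<sigma>0) ` edge_fibre \<sigma>0 a = vert_fibre \<sigma>0 (trm X a)"
proof -
  let ?e = "edge_xpath X (Fwd a)"
  have e: "?e \<in> Paths (ini X a) (trm X a)" using a by simp
  obtain e' where e': "inverse_path (ini X a) (trm X a) ?e e'" using inverse_path_exists[OF e] by blast
  have "path_class X \<sigma>0 q \<in> (\<lambda>p. path_class X \<sigma>0 (p \<star> ?e)) ` Paths \<sigma>0 (ini X a)"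
    if q: "q \<in> Paths \<sigma>0 (trm X a)" for q
    using path_class_cls[OF q cls_cancel_right[OF inverse_path_sym[OF e'] q]]
      concat_closed[OF q inverse_path_closed(2)[OF e']]
    by (metis image_eqI)
  moreover have "p \<star> ?e \<in> Paths \<sigma>0 (trm X a)" if "p \<in> Paths \<sigma>0 (ini X a)" for p
    using concat_closed[OF that e] .
  ultimately show ?thesis
    by (auto simp: edge_fibre_def vert_fibre_def image_image)
qed

lemma cmp_edge_fibre:
  assumes "a \<in> edges X" "b \<in> edges X" "ini X a = trm X b"
  shows "{cmp (universal_scwol X \<sigma>0) x y | x y. x \<in> edge_fibre \<sigma>0 a \<and> y \<in> edge_fibre \<sigma>0 b \<and>
    ini (universal_scwol X \<sigma>0) x = trm (universal_scwol X \<sigma>0) y} = edge_fibre \<sigma>0 (cmp X a b)"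
    (is "?C = _")
proof (intro equalityI subsetI)
  fix z assume "z \<in> ?C"
  then obtain q p where "z = cmp (universal_scwol X \<sigma>0) (edge_over \<sigma>0 a q) (edge_over \<sigma>0 b p)"
    "p \<in> Paths \<sigma>0 (ini X b)"
    by (auto simp: edge_fibre_def)
  then show "z \<in> edge_fibre \<sigma>0 (cmp X a b)"
    using cmp_edge_over[OF assms] assms by (auto simp: edge_fibre_def)
next
  fix z assume "z \<in> edge_fibre \<sigma>0 (cmp X a b)"
  then obtain p where p: "z = edge_over \<sigma>0 (cmp X a b) p" "p \<in> Paths \<sigma>0 (ini X b)"
    using assms by (auto simp: edge_fibre_def)
  \<comment> \<open>The lift of \<open>a\<close> is made to start where the lift of \<open>b\<close>
    ends, so that the two are composable.\<close>
  let ?q = "p \<star> edge_xpath X (Fwd b)"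
  have "?q \<in> Paths \<sigma>0 (ini X a)" using concat_closed[OF p(2)] assms by simp
  moreover have "z = cmp (universal_scwol X \<sigma>0) (edge_over \<sigma>0 a ?q) (edge_over \<sigma>0 b p)"
    using cmp_edge_over[OF assms p(2)] p(1) by simp
  ultimately show "z \<in> ?C"
    unfolding edge_fibre_def mem_Collect_eq using p(2)
    by (intro exI[of _ "edge_over \<sigma>0 a ?q"] exI[of _ "edge_over \<sigma>0 b p"]) auto
qed

text \<open>Connectedness makes each fibre nonempty, and a class common to two fibres has only one
  terminal vertex.\<close>

lemma vert_fibre_inj:
  assumes "connected_scwol X" and "\<sigma>0 \<in> verts X"
  shows "inj_on (vert_fibre \<sigma>0) (verts X)"
proof (rule inj_onI)
  fix \<sigma> \<tau> assume \<sigma>: "\<sigma> \<in> verts X" and eq: "vert_fibre \<sigma>0 \<sigma> = vert_fibre \<sigma>0 \<tau>"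
  obtain p where p: "p \<in> Paths \<sigma>0 \<sigma>" using connected_path_exists[OF assms \<sigma>] by blast
  then have "path_class X \<sigma>0 p \<in> vert_fibre \<sigma>0 \<tau>" using eq by (auto simp: vert_fibre_def)
  then obtain q where "q \<in> Paths \<sigma>0 \<tau>" "path_class X \<sigma>0 p = path_class X \<sigma>0 q"
    by (auto simp: vert_fibre_def)
  then show "\<sigma> = \<tau>" using path_class_trm_unique p by blast
qed

lemma edge_fibre_inj:
  assumes "connected_scwol X" and "\<sigma>0 \<in> verts X"
  shows "inj_on (edge_fibre \<sigma>0) (edges X)"
proof (rule inj_onI)
  fix a b assume a: "a \<in> edges X" and eq: "edge_fibre \<sigma>0 a = edge_fibre \<sigma>0 b"
  obtain p where "p \<in> Paths \<sigma>0 (ini X a)"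
    using connected_path_exists[OF assms ini_closed[OF a]] by blast
  then have "edge_over \<sigma>0 a p \<in> edge_fibre \<sigma>0 b" using eq by (auto simp: edge_fibre_def)
  then show "a = b" by (auto simp: edge_fibre_def edge_over_def)
qed

section \<open>The quotient scwol, lifts of edges, and stabilizers\<close>

abbreviation quotient :: "'v \<Rightarrow> (('v, 'e, 'g) xpath set set,
    (('v, 'e, 'g) xpath set \<times> 'e \<times> ('v, 'e, 'g) xpath set) set) scwol" where
  "quotient \<sigma>0 \<equiv> quotient_scwol (fundamental_group X \<sigma>0) (universal_scwol X \<sigma>0)
    (universal_actv X \<sigma>0) (universal_acte X \<sigma>0)"

lemma verts_quotient:
  assumes "connected_scwol X" and "\<sigma>0 \<in> verts X"
  shows "verts (quotient \<sigma>0) = vert_fibre \<sigma>0 ` verts X"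
proof -
  let ?orb = "orbit (fundamental_group X \<sigma>0) (universal_actv X \<sigma>0)"
  have "verts (quotient \<sigma>0) = {?orb (path_class X \<sigma>0 p) | p \<tau>. p \<in> Paths \<sigma>0 \<tau>}"
    unfolding quotient_scwol_def orbits_def verts_universal by fastforce
  also have "\<dots> = vert_fibre \<sigma>0 ` verts X"
  proof (intro equalityI subsetI)
    fix x assume "x \<in> {?orb (path_class X \<sigma>0 p) | p \<tau>. p \<in> Paths \<sigma>0 \<tau>}"
    then obtain p \<tau> where p: "p \<in> Paths \<sigma>0 \<tau>" and x: "x = ?orb (path_class X \<sigma>0 p)" by blast
    show "x \<in> vert_fibre \<sigma>0 ` verts X" unfolding x orbit_vert[OF p] using Paths_verts(2)[OF p] by blast
  next
    fix x assume "x \<in> vert_fibre \<sigma>0 ` verts X"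
    then obtain \<tau> where \<tau>: "x = vert_fibre \<sigma>0 \<tau>" "\<tau> \<in> verts X" by blast
    obtain p where p: "p \<in> Paths \<sigma>0 \<tau>" using connected_path_exists[OF assms \<tau>(2)] by blast
    then show "x \<in> {?orb (path_class X \<sigma>0 p) | p \<tau>. p \<in> Paths \<sigma>0 \<tau>}"
      using orbit_vert[OF p] \<tau>(1) by blast
  qed
  finally show ?thesis .
qed

lemma edges_quotient:
  assumes "connected_scwol X" and "\<sigma>0 \<in> verts X"
  shows "edges (quotient \<sigma>0) = edge_fibre \<sigma>0 ` edges X"
proof -
  let ?orb = "orbit (fundamental_group X \<sigma>0) (universal_acte X \<sigma>0)"
  let ?O = "{?orb (edge_over \<sigma>0 a p) | a p. a \<in> edges X \<and> p \<in> Paths \<sigma>0 (ini X a)}"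
  have "edges (quotient \<sigma>0) = ?O"
    unfolding quotient_scwol_def orbits_def edges_universal scwol.select_convs by blast
  also have "\<dots> = edge_fibre \<sigma>0 ` edges X"
  proof (intro equalityI subsetI)
    fix x assume "x \<in> ?O"
    then obtain a p where a: "a \<in> edges X" and p: "p \<in> Paths \<sigma>0 (ini X a)"
      and x: "x = ?orb (edge_over \<sigma>0 a p)" by blast
    show "x \<in> edge_fibre \<sigma>0 ` edges X" unfolding x orbit_edge[OF a p] using a by blast
  next
    fix x assume "x \<in> edge_fibre \<sigma>0 ` edges X"
    then obtain a where a: "x = edge_fibre \<sigma>0 a" "a \<in> edges X" by blast
    obtain p where p: "p \<in> Paths \<sigma>0 (ini X a)"
      using connected_path_exists[OF assms ini_closed[OF a(2)]] by blast
    then show "x \<in> ?O" using orbit_edge[OF a(2) p] a by blast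
  qed
  finally show ?thesis .
qed

lemma quotient_fibre:
  "ini (quotient \<sigma>0) (edge_fibre \<sigma>0 a) = vert_fibre \<sigma>0 (ini X a)"
  "a \<in> edges X \<Longrightarrow> trm (quotient \<sigma>0) (edge_fibre \<sigma>0 a) = vert_fibre \<sigma>0 (trm X a)"
  "\<lbrakk>a \<in> edges X; b \<in> edges X; ini X a = trm X b\<rbrakk>
    \<Longrightarrow> cmp (quotient \<sigma>0) (edge_fibre \<sigma>0 a) (edge_fibre \<sigma>0 b) = edge_fibre \<sigma>0 (cmp X a b)"
  by (simp_all add: quotient_scwol_def ini_edge_fibre trm_edge_fibre cmp_edge_fibre del: split_paired_Ex)

text \<open>The description in \<open>edge_lift\<close> has a unique solution because an edge with
  label \<open>a\<close> is determined by its initial class.\<close>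

lemma edge_lift_eq:
  assumes a: "a \<in> edges X" and p: "p \<in> Paths \<sigma>0 (ini X a)"
    and rep: "rep (vert_fibre \<sigma>0 (ini X a)) = path_class X \<sigma>0 p"
  shows "edge_lift (universal_scwol X \<sigma>0) rep (edge_fibre \<sigma>0 a) = edge_over \<sigma>0 a p"
  unfolding edge_lift_def ini_edge_fibre rep
proof (rule the_equality)
  show "edge_over \<sigma>0 a p \<in> edge_fibre \<sigma>0 a \<and>
      ini (universal_scwol X \<sigma>0) (edge_over \<sigma>0 a p) = path_class X \<sigma>0 p"
    using p by (auto simp: edge_fibre_def)
  fix x assume "x \<in> edge_fibre \<sigma>0 a \<and> ini (universal_scwol X \<sigma>0) x = path_class X \<sigma>0 p"
  then show "x = edge_over \<sigma>0 a p"
    using edge_over_eqI[OF a p] by (auto simp: edge_fibre_def)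
qed

text \<open>A loop \<open>r\<close> fixes the class of \<open>p\<close> exactly when
  \<open>[r \<star> p]\<close> is \<open>[p \<star> g]\<close> for a local element \<open>g\<close>;
  cancelling \<open>p\<close> on the right turns this into a formula for \<open>[r]\<close>.\<close>

lemma stabilizer_path_class:
  assumes "inverse_path \<sigma>0 \<tau> p p'"
  shows "stabilizer (fundamental_group X \<sigma>0) (universal_actv X \<sigma>0) (path_class X \<sigma>0 p) =
    (\<lambda>g. cls (p \<star> const_path \<tau> g \<star> p')) ` carrier (grp X \<tau>)"
proof -
  note p = inverse_path_closed(1)[OF assms] and p' = inverse_path_closed(2)[OF assms]
  note v = Paths_verts[OF p]
  have pg: "p \<star> const_path \<tau> g \<in> Paths \<sigma>0 \<tau>" if "g \<in> carrier (grp X \<tau>)" for g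
    using that p v by simp
  show ?thesis
  proof (intro equalityI subsetI)
    fix C assume "C \<in> stabilizer (fundamental_group X \<sigma>0) (universal_actv X \<sigma>0) (path_class X \<sigma>0 p)"
    then obtain r where r: "r \<in> Paths \<sigma>0 \<sigma>0" "C = cls r"
      "path_class X \<sigma>0 (r \<star> p) = path_class X \<sigma>0 p"
      by (auto simp: stabilizer_def carrier_fundamental_group universal_actv_path_class[OF p])
    then have "r \<star> p \<in> path_class X \<sigma>0 p"
      using path_class_eq_iff[OF p concat_closed[OF r(1) p]] by simp
    then obtain g where g: "g \<in> carrier (grp X \<tau>)" "cls (r \<star> p) = cls (p \<star> const_path \<tau> g)"
      by (auto simp: path_class_iff[OF p])
    have "cls r = cls (r \<star> p \<star> p')" using cls_cancel_right[OF assms r(1)] by simp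
    also have "\<dots> = cls (p \<star> const_path \<tau> g \<star> p')"
      by (rule cls_concat[OF g(2) refl concat_closed[OF r(1) p] p'])
    finally show "C \<in> (\<lambda>g. cls (p \<star> const_path \<tau> g \<star> p')) ` carrier (grp X \<tau>)" using r g by blast
  next
    fix C assume "C \<in> (\<lambda>g. cls (p \<star> const_path \<tau> g \<star> p')) ` carrier (grp X \<tau>)"
    then obtain g where g: "g \<in> carrier (grp X \<tau>)" "C = cls (p \<star> const_path \<tau> g \<star> p')" by blast
    have r: "p \<star> const_path \<tau> g \<star> p' \<in> Paths \<sigma>0 \<sigma>0" using pg[OF g(1)] p' by (rule concat_closed)
    have "path_class X \<sigma>0 (p \<star> const_path \<tau> g \<star> p' \<star> p) = path_class X \<sigma>0 p"
      using path_class_eq_rightI[OF p g(1)] cls_cancel_right[OF inverse_path_sym[OF assms] pg[OF g(1)]]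
      by simp
    then show "C \<in> stabilizer (fundamental_group X \<sigma>0) (universal_actv X \<sigma>0) (path_class X \<sigma>0 p)"
      using r g(2) by (auto simp: stabilizer_def carrier_fundamental_group universal_actv_path_class[OF p r])
  qed
qed

end

text \<open>The choices \<open>rep\<close> and \<open>h\<close> are arbitrary, so every complex of
  groups induced by this action is covered.\<close>

theorem proposition3p12:
  fixes X :: "('v, 'e, 'g) complex_of_groups" and \<sigma>0 :: 'v
    and rep :: "('v, 'e, 'g) xpath set set \<Rightarrow> ('v, 'e, 'g) xpath set"
    and h :: "(('v, 'e, 'g) xpath set \<times> 'e \<times> ('v, 'e, 'g) xpath set) set \<Rightarrow> ('v, 'e, 'g) xpath set"
  assumes "complex_of_groups X"
    and "developable X"
    and "connected_scwol X"
    and "\<sigma>0 \<in> verts X"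
    and "induced_choice (fundamental_group X \<sigma>0) (universal_scwol X \<sigma>0)
           (universal_actv X \<sigma>0) (universal_acte X \<sigma>0) rep h"
  shows "\<exists>\<phi>. complex_isomorphism X
           (induced_complex (fundamental_group X \<sigma>0) (universal_scwol X \<sigma>0)
             (universal_actv X \<sigma>0) (universal_acte X \<sigma>0) rep h) \<phi>"
proof -
  interpret complex_of_groups X by fact
  define \<Gamma> where "\<Gamma> = fundamental_group X \<sigma>0"
  define W where "W = quotient \<sigma>0"
  define S where "S = (\<lambda>\<sigma>. stabilizer \<Gamma> (universal_actv X \<sigma>0) (rep \<sigma>))"
  let ?V = "vert_fibre \<sigma>0" and ?E = "edge_fibre \<sigma>0"
  note verts_W = verts_quotient[OF assms(3,4), folded W_def]
    and edges_W = edges_quotient[OF assms(3,4), folded W_def]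
    and W_fibre = quotient_fibre(1)[of \<sigma>0, folded W_def]
      quotient_fibre(2)[of _ \<sigma>0, folded W_def] quotient_fibre(3)[of _ _ \<sigma>0, folded W_def]
  have rep: "rep (?V \<sigma>) \<in> ?V \<sigma>" if "\<sigma> \<in> verts X" for \<sigma>
    using assms(5) that verts_W by (auto simp: induced_choice_def Let_def W_def)
  have h: "h (?E a) \<in> carrier \<Gamma>" "universal_actv X \<sigma>0 (h (?E a))
      (trm (universal_scwol X \<sigma>0) (edge_lift (universal_scwol X \<sigma>0) rep (?E a))) = rep (?V (trm X a))"
    if "a \<in> edges X" for a
    using assms(5) that edges_W W_fibre(2)[OF that]
    by (auto simp: induced_choice_def Let_def W_def \<Gamma>_def)
  \<comment> \<open>A representative lies in its own fibre, hence is the class of some path ending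
    at \<open>\<sigma>\<close>. Such a path and an inverse are fixed for all vertices at
    once.\<close>
  have "\<exists>p p'. rep (?V \<sigma>) = path_class X \<sigma>0 p \<and> inverse_path \<sigma>0 \<sigma> p p'" if "\<sigma> \<in> verts X" for \<sigma>
    using rep[OF that] inverse_path_exists by (auto simp: vert_fibre_def)
  then obtain P P' where rep_P: "rep (?V \<sigma>) = path_class X \<sigma>0 (P \<sigma>)"
    and P_P': "inverse_path \<sigma>0 \<sigma> (P \<sigma>) (P' \<sigma>)" if "\<sigma> \<in> verts X" for \<sigma>
    by metis
  have P: "P \<sigma> \<in> Paths \<sigma>0 \<sigma>" and P': "P' \<sigma> \<in> Paths \<sigma> \<sigma>0" if "\<sigma> \<in> verts X" for \<sigma>
    using inverse_path_closed[OF P_P'[OF that]] .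
  \<comment> \<open>The chosen paths form a spanning tree up to homotopy: \<open>\<kappa>\<close> is a faithful functor from the
    fundamental groupoid to the group \<open>\<Gamma>\<close>.\<close>
  define \<kappa> where "\<kappa> = (\<lambda>\<sigma> \<tau> q. cls (P \<sigma> \<star> q \<star> P' \<tau>))"
  have \<kappa>_closed: "P \<sigma> \<star> q \<star> P' \<tau> \<in> Paths \<sigma>0 \<sigma>0" if "q \<in> Paths \<sigma> \<tau>" for \<sigma> \<tau> q
    using P P' Paths_verts[OF that] that by (meson concat_closed)
  then have \<kappa>_carrier: "\<kappa> \<sigma> \<tau> q \<in> carrier \<Gamma>" if "q \<in> Paths \<sigma> \<tau>" for \<sigma> \<tau> q
    using that by (auto simp: \<Gamma>_def carrier_fundamental_group \<kappa>_def)
  have \<kappa>_mult: "\<kappa> \<sigma> \<tau> q \<otimes>\<^bsub>\<Gamma>\<^esub> \<kappa> \<tau> \<rho> r = \<kappa> \<sigma> \<rho> (q \<star> r)" if q: "q \<in> Paths \<sigma> \<tau>" and r: "r \<in> Paths \<tau> \<rho>"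
    for \<sigma> \<tau> \<rho> q r
  proof -
    note v = Paths_verts[OF q] Paths_verts(2)[OF r]
    note mem = P[OF v(1)] P'[OF v(2)] P[OF v(2)] P'[OF v(3)]
    have "\<kappa> \<sigma> \<tau> q \<otimes>\<^bsub>\<Gamma>\<^esub> \<kappa> \<tau> \<rho> r = cls (P \<sigma> \<star> q \<star> P' \<tau> \<star> (P \<tau> \<star> r \<star> P' \<rho>))"
      unfolding \<kappa>_def \<Gamma>_def by (rule mult_fundamental_group[OF \<kappa>_closed[OF q] \<kappa>_closed[OF r]])
    also have "P \<tau> \<star> r \<star> P' \<rho> = P \<tau> \<star> (r \<star> P' \<rho>)"
      by (rule concat_assoc[OF mem(3) r mem(4)])
    also have "cls (P \<sigma> \<star> q \<star> P' \<tau> \<star> \<dots>) = cls (P \<sigma> \<star> q \<star> (r \<star> P' \<rho>))"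
      by (rule cls_cancel_middle[OF inverse_path_sym[OF P_P'[OF v(2)]] concat_closed[OF mem(1) q]
          concat_closed[OF r mem(4)]])
    also have "P \<sigma> \<star> q \<star> (r \<star> P' \<rho>) = P \<sigma> \<star> q \<star> r \<star> P' \<rho>"
      by (rule concat_assoc[OF concat_closed[OF mem(1) q] r mem(4), symmetric])
    also have "P \<sigma> \<star> q \<star> r = P \<sigma> \<star> (q \<star> r)"
      by (rule concat_assoc[OF mem(1) q r])
    finally show ?thesis by (simp add: \<kappa>_def)
  qed
  have \<kappa>_eq_iff: "\<kappa> \<sigma> \<tau> q = \<kappa> \<sigma> \<tau> r \<longleftrightarrow> cls q = cls r" if q: "q \<in> Paths \<sigma> \<tau>" and r: "r \<in> Paths \<sigma> \<tau>" for \<sigma> \<tau> q r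
  proof
    note v = Paths_verts[OF q]
    note mem = P[OF v(1)] P'[OF v(1)] P[OF v(2)] P'[OF v(2)]
    \<comment> \<open>Surrounding the loop with the chosen paths in the opposite direction recovers
      the class of \<open>x\<close>; this gives faithfulness.\<close>
    have *: "cls (P' \<sigma> \<star> (P \<sigma> \<star> x \<star> P' \<tau>) \<star> P \<tau>) = cls x" if x: "x \<in> Paths \<sigma> \<tau>" for x
    proof -
      have "P' \<sigma> \<star> (P \<sigma> \<star> x \<star> P' \<tau>) = P' \<sigma> \<star> (P \<sigma> \<star> x) \<star> P' \<tau>"
        by (rule concat_assoc[OF mem(2) concat_closed[OF mem(1) x] mem(4), symmetric])
      then have "cls (P' \<sigma> \<star> (P \<sigma> \<star> x \<star> P' \<tau>) \<star> P \<tau>) = cls (P' \<sigma> \<star> (P \<sigma> \<star> x))"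
        using cls_cancel_right[OF inverse_path_sym[OF P_P'[OF v(2)]]
            concat_closed[OF mem(2) concat_closed[OF mem(1) x]]] by simp
      also have "P' \<sigma> \<star> (P \<sigma> \<star> x) = const_path \<sigma> \<one>\<^bsub>grp X \<sigma>\<^esub> \<star> P' \<sigma> \<star> (P \<sigma> \<star> x)"
        using mem by simp
      also have "cls \<dots> = cls (const_path \<sigma> \<one>\<^bsub>grp X \<sigma>\<^esub> \<star> x)"
        by (rule cls_cancel_middle[OF inverse_path_sym[OF P_P'[OF v(1)]]
              const_path_closed[OF v(1) one_at_closed[OF v(1)]] x])
      finally show ?thesis using x by simp
    qed
    assume "\<kappa> \<sigma> \<tau> q = \<kappa> \<sigma> \<tau> r"
    then have "cls (P \<sigma> \<star> q \<star> P' \<tau>) = cls (P \<sigma> \<star> r \<star> P' \<tau>)" by (simp add: \<kappa>_def)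
    then have "cls (P' \<sigma> \<star> (P \<sigma> \<star> q \<star> P' \<tau>) \<star> P \<tau>) = cls (P' \<sigma> \<star> (P \<sigma> \<star> r \<star> P' \<tau>) \<star> P \<tau>)"
      using cls_concat[OF cls_concat[OF refl _ mem(2) \<kappa>_closed[OF q]] refl _ mem(3)]
        concat_closed[OF mem(2) \<kappa>_closed[OF q]] by blast
    then show "cls q = cls r" by (simp add: * q r)
  next
    note v = Paths_verts[OF q]
    assume "cls q = cls r"
    then show "\<kappa> \<sigma> \<tau> q = \<kappa> \<sigma> \<tau> r"
      unfolding \<kappa>_def
      by (rule cls_concat[OF cls_concat[OF refl _ P[OF v(1)] q] refl concat_closed[OF P[OF v(1)] q] P'[OF v(2)]])
  qed
  define \<phi> where "\<phi> = (\<lambda>\<sigma> g. \<kappa> \<sigma> \<sigma> (const_path \<sigma> g))"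
  define A where "A = (\<lambda>a. \<kappa> (ini X a) (trm X a) (edge_xpath X (Fwd a)))"
  have S_eq: "S (?V \<sigma>) = \<phi> \<sigma> ` carrier (grp X \<sigma>)" if "\<sigma> \<in> verts X" for \<sigma>
    unfolding S_def \<Gamma>_def rep_P[OF that] \<phi>_def \<kappa>_def by (rule stabilizer_path_class[OF P_P'[OF that]])
  interpret E: embedded_complex X \<Gamma> W S h ?V ?E \<phi> A
  proof (intro embedded_complex.intro embedded_complex_axioms.intro)
    show "complex_of_groups X" ..
    show "group \<Gamma>" unfolding \<Gamma>_def by (rule group_fundamental_group[OF assms(4)])
    show "bij_betw ?V (verts X) (verts W)" "bij_betw ?E (edges X) (edges W)"
      using vert_fibre_inj[OF assms(3,4)] edge_fibre_inj[OF assms(3,4)] verts_W edges_W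
      by (auto simp: bij_betw_def)
    show "ini W (?E a) = ?V (ini X a)" for a by (rule W_fibre)
    show "trm W (?E a) = ?V (trm X a)" if "a \<in> edges X" for a using that by (rule W_fibre)
    show "cmp W (?E a) (?E b) = ?E (cmp X a b)"
      if "a \<in> edges X" "b \<in> edges X" "ini X a = trm X b" for a b
      using that by (rule W_fibre)
    show "\<phi> \<sigma> \<in> hom (grp X \<sigma>) \<Gamma>" if "\<sigma> \<in> verts X" for \<sigma>
      using that by (intro homI) (simp_all add: \<phi>_def \<kappa>_carrier \<kappa>_mult const_concat)
    \<comment> \<open>Faithfulness of \<open>\<kappa>\<close> reduces this to injectivity of
      \<open>g\<close> mapping to the class of its constant path, which is developability at
      \<open>\<sigma>\<close>.\<close>
    show "inj_on (\<phi> \<sigma>) (carrier (grp X \<sigma>))" if "\<sigma> \<in> verts X" for \<sigma>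
      using that assms(2) by (auto simp: inj_on_def \<phi>_def \<kappa>_eq_iff developable_def)
    show "\<phi> \<sigma> ` carrier (grp X \<sigma>) = S (?V \<sigma>)" if "\<sigma> \<in> verts X" for \<sigma>
      using S_eq[OF that] by simp
    show "h (?E a) \<in> carrier \<Gamma>" if "a \<in> edges X" for a using that by (rule h)
    show "A a \<in> carrier \<Gamma>" if "a \<in> edges X" for a using that by (simp add: A_def \<kappa>_carrier)
    show "\<phi> (ini X a) g \<otimes>\<^bsub>\<Gamma>\<^esub> A a = A a \<otimes>\<^bsub>\<Gamma>\<^esub> \<phi> (trm X a) (psi X a g)"
      if a: "a \<in> edges X" and g: "g \<in> carrier (grp X (ini X a))" for a g
    proof -
      let ?e = "edge_xpath X (Fwd a)"
      let ?l = "const_path (ini X a) g" and ?r = "const_path (trm X a) (psi X a g)"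
      have e: "?e \<in> Paths (ini X a) (trm X a)" and l: "?l \<in> Paths (ini X a) (ini X a)"
        and r: "?r \<in> Paths (trm X a) (trm X a)"
        using a g by simp_all
      have "\<kappa> (ini X a) (trm X a) (?l \<star> ?e) = \<kappa> (ini X a) (trm X a) (?e \<star> ?r)"
        using \<kappa>_eq_iff[OF concat_closed[OF l e] concat_closed[OF e r]] cls_const_edge[OF a g] by blast
      then show ?thesis by (simp add: \<phi>_def A_def \<kappa>_mult[OF l e] \<kappa>_mult[OF e r])
    qed
    show "A b \<otimes>\<^bsub>\<Gamma>\<^esub> A a \<otimes>\<^bsub>\<Gamma>\<^esub> \<phi> (trm X a) (twist X a b) = A (cmp X a b)"
      if ab: "a \<in> edges X" "b \<in> edges X" "ini X a = trm X b" for a b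
    proof -
      let ?a = "edge_xpath X (Fwd a)" and ?b = "edge_xpath X (Fwd b)"
        and ?ab = "edge_xpath X (Fwd (cmp X a b))" and ?g = "const_path (trm X a) (twist X a b)"
      have a: "?a \<in> Paths (trm X b) (trm X a)" and b: "?b \<in> Paths (ini X b) (trm X b)"
        and g: "?g \<in> Paths (trm X a) (trm X a)"
        using ab edge_xpath_Fwd_closed[of a] by simp_all
      have c: "?ab \<in> Paths (ini X b) (trm X a)"
        using ab edge_xpath_Fwd_closed[of "cmp X a b"] by simp
      have ba: "?b \<star> ?a \<in> Paths (ini X b) (trm X a)" using b a by (rule concat_closed)
      have "\<kappa> (ini X b) (trm X a) (?b \<star> ?a \<star> ?g) = \<kappa> (ini X b) (trm X a) ?ab"
        using \<kappa>_eq_iff[OF concat_closed[OF ba g] c] cls_edge_cmp[OF ab] by blast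
      then show ?thesis using ab by (simp add: \<phi>_def A_def \<kappa>_mult[OF b a] \<kappa>_mult[OF ba g])
    qed
    show "h (?E a) \<otimes>\<^bsub>\<Gamma>\<^esub> A a \<in> S (?V (trm X a))" if a: "a \<in> edges X" for a
    proof -
      let ?e = "edge_xpath X (Fwd a)"
      have v: "ini X a \<in> verts X" "trm X a \<in> verts X" and e: "?e \<in> Paths (ini X a) (trm X a)"
        using a by simp_all
      obtain r where r: "r \<in> Paths \<sigma>0 \<sigma>0" "h (?E a) = cls r"
        using h(1)[OF a] by (auto simp: \<Gamma>_def carrier_fundamental_group)
      \<comment> \<open>This path represents the terminal vertex of the lifted edge, so
        \<open>h (?E a)\<close> moves its class to the representative over
        \<open>trm X a\<close>.\<close>
      define p where "p = P (ini X a) \<star> ?e"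
      have p: "p \<in> Paths \<sigma>0 (trm X a)" unfolding p_def using P[OF v(1)] e by (rule concat_closed)
      note P1 = P[OF v(2)] P'[OF v(2)]
      have pP: "p \<star> P' (trm X a) \<in> Paths \<sigma>0 \<sigma>0" using p P1(2) by (rule concat_closed)
      have rep_eq: "path_class X \<sigma>0 (r \<star> p) = path_class X \<sigma>0 (P (trm X a))"
        using h(2)[OF a] universal_actv_path_class[OF p r(1)] rep_P[OF v(2)]
        by (simp add: edge_lift_eq[where rep = rep, OF a P[OF v(1)] rep_P[OF v(1)]] r(2) p_def)
      have eq: "h (?E a) \<otimes>\<^bsub>\<Gamma>\<^esub> A a = cls (r \<star> (p \<star> P' (trm X a)))"
        using mult_fundamental_group[OF r(1) pP] by (simp add: A_def \<kappa>_def \<Gamma>_def r(2) p_def)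
      have rpP: "r \<star> (p \<star> P' (trm X a)) \<in> Paths \<sigma>0 \<sigma>0" using r(1) pP by (rule concat_closed)
      \<comment> \<open>Acting on the class of \<open>P (trm X a)\<close>, the tail
        \<open>P' (trm X a)\<close> cancels, so \<open>h (?E a) \<otimes> A a\<close> sends the
        representative to the class of \<open>r \<star> p\<close>, that is, back to itself.\<close>
      have "cls (r \<star> (p \<star> P' (trm X a)) \<star> P (trm X a)) = cls (r \<star> p)"
        using concat_assoc[OF r(1) p P1(2)]
          cls_cancel_right[OF inverse_path_sym[OF P_P'[OF v(2)]] concat_closed[OF r(1) p]] by simp
      then have "path_class X \<sigma>0 (r \<star> (p \<star> P' (trm X a)) \<star> P (trm X a)) = path_class X \<sigma>0 (P (trm X a))"
        using path_class_cls[OF concat_closed[OF r(1) p]] rep_eq by simp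
      then show ?thesis
        unfolding S_def stabilizer_def eq rep_P[OF v(2)]
        using universal_actv_path_class[OF P1(1) rpP] rpP by (auto simp: \<Gamma>_def carrier_fundamental_group)
    qed
  qed
  have "induced_complex (fundamental_group X \<sigma>0) (universal_scwol X \<sigma>0)
      (universal_actv X \<sigma>0) (universal_acte X \<sigma>0) rep h = E.realized"
    unfolding E.realized_def by (simp add: induced_complex_def Let_def W_def \<Gamma>_def S_def)
  then show ?thesis using E.isomorphism by auto
qed

end
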